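(* Assume A1 (the Hessian of $f$ is $L$-Lipschitz). The algorithm First-Order CNM (described in the context), run with $m:=n$ from $x_0\in Q$ with $\tau_0>0$ and $\epsilon>0$, needs at most $$\mathcal{O}\bigl(n^{1/2}\epsilon^{-3/2}+n\bigr)$$ total function and gradient evaluations of $f$ to generate $x_k$ such that $\|\nabla f(x_k)+\psi'(x_k)\|\le\epsilon$ for some $\psi'(x_k)\in\partial\psi(x_k)$, where the constant hidden in $\mathcal{O}(\cdot)$ depends only on $\tau_0$, $L$ and $F(x_0)-F^\star$ (not on $n$ or $\epsilon$).
   Context: Setting: $\|\cdot\|$ is the Euclidean norm for vectors and the spectral norm for matrices; $e_1,\dots,e_n$ is the standard basis of $\mathbb{R}^n$. $f:\mathbb{R}^n\to\mathbb{R}$ is twice continuously differentiable (possibly non-convex), $\psi:\mathbb{R}^n\to\mathbb{R}\cup\{+\infty\}$ is proper, closed and convex (possibly non-differentiable), $Q=\operatorname{dom}\psi$, $F=f+\psi$, and $F^\star=\inf_{x\in Q}F(x)>-\infty$. Assumption A1: $\|\nabla^2 f(y)-\nabla^2 f(x)\|\le L\|y-x\|$ for all $x,y\in\mathbb{R}^n$, where $L\ge 0$. Procedure CubicSteps$(x,B,\sigma,m,\epsilon)$ ($x\in Q$, $B=B^\top\in\mathbb{R}^{n\times n}$, $\sigma>0$, $m\ge1$, $\epsilon>0$): Step 0: set $x_0:=x$, $t:=0$. Step 1: if $t=m$, stop and return $(x_t,\text{success})$. Step 2: with $M_{x_t,\sigma}(y)=f(x_t)+\langle\nabla f(x_t),y-x_t\rangle+\frac12\langle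 B(y-x_t),y-x_t\rangle+\frac{\sigma}{6}\|y-x_t\|^3$, compute $x_{t+1}\in Q$ as an approximate minimizer of $M_{x_t,\sigma}+\psi$ over $Q$ such that $M_{x_t,\sigma}(x_{t+1})+\psi(x_{t+1})\le F(x_t)$ and $\|\nabla M_{x_t,\sigma}(x_{t+1})+\psi'(x_{t+1})\|\le\frac{\sigma}{4}\|x_{t+1}-x_t\|^2$ for some $\psi'(x_{t+1})\in\partial\psi(x_{t+1})$. Step 3: if $\|\nabla f(x_{t+1})+\psi'(x_{t+1})\|\le\epsilon$ (same subgradient), stop and return $(x_{t+1},\text{solution})$. Step 4: if $F(x_0)-F(x_{t+1})\ge\frac{\epsilon^{3/2}}{384\,\sigma^{1/2}}(t+1)$, set $t:=t+1$ and go to Step 1; otherwise stop and return $(x_{t+1},\text{halt})$. Algorithm First-Order CNM: Step 0: given $x_0\in Q$, $\tau_0>0$, $\epsilon>0$, $m\ge1$, set $k:=0$. Step 1: set $\ell:=0$. Step 1.1: with $\sigma_{k,\ell}=2^4(2/3)^{1/3}(2^\ell\tau_k)m$ and $h_{k,\ell}=\Bigl[\frac{3\,\sigma_{k,\ell}^{3/2}\epsilon^{3/2}}{2^7\cdot192\,n^{3/2}(2^\ell\tau_k)^3}\Bigr]^{1/3}$, compute $B_{k,\ell}=\frac12(A_{k,\ell}+A_{k,\ell}^\top)$, where the $i$-th column of $A_{k,\ell}$ is $\frac{\nabla f(x_k+h_{k,\ell}e_i)-\nabla f(x_k)}{h_{k,\ell}}$. Step 1.2: $(\hat x_{k,\ell},\alpha_{k,\ell}):=$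 CubicSteps$(x_k,B_{k,\ell},\sigma_{k,\ell},m,\epsilon)$. Step 2: if $\alpha_{k,\ell}=\text{halt}$, set $\ell:=\ell+1$ and go to Step 1.1. Step 3: let $\ell_k$ be the current $\ell$ and set $x_{k+1}=\hat x_{k,\ell_k}$. Step 4: if $\alpha_{k,\ell_k}=\text{success}$, set $\tau_{k+1}=\max\{\tau_0,2^{\ell_k-1}\tau_k\}$, $k:=k+1$, and go to Step 1; otherwise stop. Evaluations are counted as calls of the first-order oracle $x\mapsto\{f(x),\nabla f(x)\}$: evaluating $f$ and/or $\nabla f$ at one point counts as one. *)

theory Defs
  imports "HOL-Analysis.Analysis"
begin

text \<open>
  The constant hidden in the complexity bound must not depend on the dimension n, so n has to be
  quantified inside the statement, after the constant; this excludes the type \<open>real ^ 'n\<close>.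
  We use the inner product space \<open>fseq\<close> of finitely supported real sequences and realise the
  Euclidean n-space as its subspace \<open>Rn n\<close> of the sequences supported in \<open>{..<n}\<close>. On \<open>Rn n\<close> the
  inner product, the norm and the topology inherited from \<open>fseq\<close> are the Euclidean ones.
\<close>

typedef fseq = "{x :: nat \<Rightarrow> real. finite {i. x i \<noteq> 0}}"
  morphisms coord Abs_fseq
  by (rule exI[of _ "\<lambda>_. 0"]) simp

lemma finite_support: "finite {i. coord x i \<noteq> 0}"
  using coord[of x] by simp

lemma coord_Abs: "finite {i. x i \<noteq> 0} \<Longrightarrow> coord (Abs_fseq x) = x"
  by (simp add: Abs_fseq_inverse)

lemma fseq_eqI: "(\<And>i. coord x i = coord y i) \<Longrightarrow> x = y"
  by (metis coord_inject ext)

instantiation fseq :: real_vector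
begin

definition zero_fseq :: fseq where "0 = Abs_fseq (\<lambda>_. 0)"
definition plus_fseq :: "fseq \<Rightarrow> fseq \<Rightarrow> fseq"
  where "x + y = Abs_fseq (\<lambda>i. coord x i + coord y i)"
definition minus_fseq :: "fseq \<Rightarrow> fseq \<Rightarrow> fseq"
  where "x - y = Abs_fseq (\<lambda>i. coord x i - coord y i)"
definition uminus_fseq :: "fseq \<Rightarrow> fseq"
  where "- x = Abs_fseq (\<lambda>i. - coord x i)"
definition scaleR_fseq :: "real \<Rightarrow> fseq \<Rightarrow> fseq"
  where "c *\<^sub>R x = Abs_fseq (\<lambda>i. c * coord x i)"

lemma coord_zero [simp]: "coord 0 i = 0"
  by (simp add: zero_fseq_def coord_Abs)

lemma coord_add [simp]: "coord (x + y) i = coord x i + coord y i"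
proof -
  have "finite {i. coord x i + coord y i \<noteq> 0}"
    by (rule finite_subset[OF _ finite_UnI[OF finite_support[of x] finite_support[of y]]]) auto
  then show ?thesis by (simp add: plus_fseq_def coord_Abs)
qed

lemma coord_diff [simp]: "coord (x - y) i = coord x i - coord y i"
proof -
  have "finite {i. coord x i - coord y i \<noteq> 0}"
    by (rule finite_subset[OF _ finite_UnI[OF finite_support[of x] finite_support[of y]]]) auto
  then show ?thesis by (simp add: minus_fseq_def coord_Abs)
qed

lemma coord_minus [simp]: "coord (- x) i = - coord x i"
  using finite_support[of x] by (simp add: uminus_fseq_def coord_Abs)

lemma coord_scaleR [simp]: "coord (c *\<^sub>R x) i = c * coord x i"
proof -
  have "finite {i. c * coord x i \<noteq> 0}"
    by (rule finite_subset[OF _ finite_support[of x]]) auto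
  then show ?thesis by (simp add: scaleR_fseq_def coord_Abs)
qed

instance
  by standard (rule fseq_eqI, simp add: algebra_simps)+

end

instantiation fseq :: real_inner
begin

definition inner_fseq :: "fseq \<Rightarrow> fseq \<Rightarrow> real"
  where "inner x y = (\<Sum>i\<in>{i. coord x i \<noteq> 0}. coord x i * coord y i)"
definition norm_fseq :: "fseq \<Rightarrow> real" where "norm x = sqrt (inner x (x :: fseq))"
definition dist_fseq :: "fseq \<Rightarrow> fseq \<Rightarrow> real" where "dist x y = norm (x - y :: fseq)"
definition sgn_fseq :: "fseq \<Rightarrow> fseq" where "sgn x = x /\<^sub>R norm (x :: fseq)"
definition uniformity_fseq :: "(fseq \<times> fseq) filter"
  where "uniformity_fseq = (INF e\<in>{0<..}. principal {(x, y). dist x (y :: fseq) < e})"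
definition open_fseq :: "fseq set \<Rightarrow> bool"
  where "open_fseq U = (\<forall>x\<in>U. \<forall>\<^sub>F (x', y) in uniformity. x' = x \<longrightarrow> y \<in> U)"

lemma inner_fseq_sum:
  assumes "finite I" "{i. coord x i \<noteq> 0} \<subseteq> I"
  shows "inner x y = (\<Sum>i\<in>I. coord x i * coord y i)"
  unfolding inner_fseq_def by (rule sum.mono_neutral_left) (use assms in auto)

instance
proof
  fix x y z :: fseq and r :: real
  let ?S = "\<lambda>x. {i. coord x i \<noteq> 0}"
  let ?I = "?S x \<union> ?S y \<union> ?S z"
  have fin: "finite ?I" by (simp add: finite_support)
  note eq = inner_fseq_sum[OF fin]
  show "dist x y = norm (x - y)" by (fact dist_fseq_def)
  show "sgn x = x /\<^sub>R norm x" by (fact sgn_fseq_def)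
  show "(uniformity :: (fseq \<times> fseq) filter) = (INF e\<in>{0<..}. principal {(x, y). dist x y < e})"
    by (fact uniformity_fseq_def)
  show "open U = (\<forall>x\<in>U. \<forall>\<^sub>F (x', y) in uniformity. x' = x \<longrightarrow> y \<in> U)" for U :: "fseq set"
    by (fact open_fseq_def)
  show "norm x = sqrt (inner x x)" by (fact norm_fseq_def)
  show "inner x y = inner y x"
    by (subst (1 2) eq) (auto simp: mult.commute)
  show "inner (x + y) z = inner x z + inner y z"
    by (subst (1 2 3) eq) (auto simp: distrib_right sum.distrib)
  show "inner (r *\<^sub>R x) y = r * inner x y"
    by (subst (1 2) eq) (auto simp: sum_distrib_left mult.assoc)
  show "0 \<le> inner x x"
    by (simp add: inner_fseq_def sum_nonneg)
  show "inner x x = 0 \<longleftrightarrow> x = 0"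
  proof
    assume "inner x x = 0"
    then have "\<forall>i\<in>?S x. coord x i * coord x i = 0"
      unfolding inner_fseq_def by (subst (asm) sum_nonneg_eq_0_iff) (auto simp: finite_support)
    then show "x = 0" by (intro fseq_eqI) auto
  qed (simp add: inner_fseq_def)
qed

end

definition Rn :: "nat \<Rightarrow> fseq set"
  where "Rn n = {x. \<forall>i\<ge>n. coord x i = 0}"

definition unit_vec :: "nat \<Rightarrow> fseq"
  where "unit_vec i = Abs_fseq (\<lambda>j. if j = i then 1 else 0)"

text \<open>An n-by-n matrix is a function \<open>A :: nat \<Rightarrow> nat \<Rightarrow> real\<close>, of which only the entries with
  both (zero-based) indices below n matter.\<close>

type_synonym matr = "nat \<Rightarrow> nat \<Rightarrow> real"

definition mat_vec :: "nat \<Rightarrow> matr \<Rightarrow> fseq \<Rightarrow> fseq"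
  where "mat_vec n A v = (\<Sum>i<n. (\<Sum>j<n. A i j * coord v j) *\<^sub>R unit_vec i)"

text \<open>The map \<open>mat_vec n A\<close> ignores the coordinates of its argument beyond n, so its operator
  norm on \<open>fseq\<close> is the one on \<open>Rn n\<close>, i.e. the spectral norm of A.\<close>

definition spectral_norm :: "nat \<Rightarrow> matr \<Rightarrow> real"
  where "spectral_norm n A = onorm (mat_vec n A)"

definition has_gradient :: "nat \<Rightarrow> (fseq \<Rightarrow> real) \<Rightarrow> fseq \<Rightarrow> fseq \<Rightarrow> bool"
  where "has_gradient n f g x \<longleftrightarrow>
    g \<in> Rn n \<and> (f has_derivative (\<lambda>v. inner g v)) (at x within Rn n)"

definition gradient :: "nat \<Rightarrow> (fseq \<Rightarrow> real) \<Rightarrow> fseq \<Rightarrow> fseq"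
  where "gradient n f x = (THE g. has_gradient n f g x)"

definition has_hessian :: "nat \<Rightarrow> (fseq \<Rightarrow> real) \<Rightarrow> matr \<Rightarrow> fseq \<Rightarrow> bool"
  where "has_hessian n f H x \<longleftrightarrow>
    (\<forall>i j. i \<ge> n \<or> j \<ge> n \<longrightarrow> H i j = 0) \<and>
    (gradient n f has_derivative mat_vec n H) (at x within Rn n)"

definition hessian :: "nat \<Rightarrow> (fseq \<Rightarrow> real) \<Rightarrow> fseq \<Rightarrow> matr"
  where "hessian n f x = (THE H. has_hessian n f H x)"

definition C2 :: "nat \<Rightarrow> (fseq \<Rightarrow> real) \<Rightarrow> bool"
  where "C2 n f \<longleftrightarrow>
    (\<forall>x\<in>Rn n. \<exists>g. has_gradient n f g x) \<and>
    (\<forall>x\<in>Rn n. \<exists>H. has_hessian n f H x) \<and>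
    (\<forall>i<n. \<forall>j<n. continuous_on (Rn n) (\<lambda>x. hessian n f x i j))"

definition hessian_lipschitz :: "nat \<Rightarrow> (fseq \<Rightarrow> real) \<Rightarrow> real \<Rightarrow> bool"
  where "hessian_lipschitz n f L \<longleftrightarrow>
    (\<forall>x\<in>Rn n. \<forall>y\<in>Rn n.
       spectral_norm n (\<lambda>i j. hessian n f y i j - hessian n f x i j) \<le> L * norm (y - x))"

definition eff_dom :: "nat \<Rightarrow> (fseq \<Rightarrow> ereal) \<Rightarrow> fseq set"
  where "eff_dom n \<psi> = {x \<in> Rn n. \<psi> x < \<infinity>}"

definition epi :: "nat \<Rightarrow> (fseq \<Rightarrow> ereal) \<Rightarrow> (fseq \<times> real) set"
  where "epi n \<psi> = {(x, r). x \<in> Rn n \<and> \<psi> x \<le> ereal r}"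

text \<open>\<open>Rn n\<close> is closed in \<open>fseq\<close>, so the epigraph is closed in \<open>fseq \<times> real\<close> iff it is closed
  relative to \<open>Rn n \<times> UNIV\<close>.\<close>

definition proper_closed_convex :: "nat \<Rightarrow> (fseq \<Rightarrow> ereal) \<Rightarrow> bool"
  where "proper_closed_convex n \<psi> \<longleftrightarrow>
    (\<forall>x\<in>Rn n. \<psi> x \<noteq> -\<infinity>) \<and> eff_dom n \<psi> \<noteq> {} \<and>
    closed (epi n \<psi>) \<and> convex (epi n \<psi>)"

definition subdifferential :: "nat \<Rightarrow> (fseq \<Rightarrow> ereal) \<Rightarrow> fseq \<Rightarrow> fseq set"
  where "subdifferential n \<psi> x =
    {p \<in> Rn n. x \<in> eff_dom n \<psi> \<and> (\<forall>y\<in>Rn n. \<psi> y \<ge> \<psi> x + ereal (inner p (y - x)))}"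

definition composite :: "(fseq \<Rightarrow> real) \<Rightarrow> (fseq \<Rightarrow> ereal) \<Rightarrow> fseq \<Rightarrow> ereal"
  where "composite f \<psi> x = ereal (f x) + \<psi> x"

definition opt_value :: "nat \<Rightarrow> (fseq \<Rightarrow> real) \<Rightarrow> (fseq \<Rightarrow> ereal) \<Rightarrow> ereal"
  where "opt_value n f \<psi> = (INF x\<in>eff_dom n \<psi>. composite f \<psi> x)"

definition eps_stationary ::
  "nat \<Rightarrow> (fseq \<Rightarrow> real) \<Rightarrow> (fseq \<Rightarrow> ereal) \<Rightarrow> real \<Rightarrow> fseq \<Rightarrow> bool"
  where "eps_stationary n f \<psi> \<epsilon> x \<longleftrightarrow>
    (\<exists>p\<in>subdifferential n \<psi> x. norm (gradient n f x + p) \<le> \<epsilon>)"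

definition cubic_model ::
  "nat \<Rightarrow> (fseq \<Rightarrow> real) \<Rightarrow> matr \<Rightarrow> real \<Rightarrow> fseq \<Rightarrow> fseq \<Rightarrow> real"
  where "cubic_model n f B \<sigma> x y =
    f x + inner (gradient n f x) (y - x) + 1/2 * inner (mat_vec n B (y - x)) (y - x)
    + \<sigma> / 6 * norm (y - x) ^ 3"

text \<open>\<open>inexact_step n f \<psi> B \<sigma> x y p\<close>: from x, the point y is an admissible approximate minimizer
  of the regularized model, with p the subgradient of \<psi> at y that certifies it. The same p is
  used afterwards in the stopping test of CubicSteps.\<close>

definition inexact_step ::
  "nat \<Rightarrow> (fseq \<Rightarrow> real) \<Rightarrow> (fseq \<Rightarrow> ereal) \<Rightarrow> matr \<Rightarrow> real \<Rightarrow> fseq \<Rightarrow> fseq \<Rightarrow> fseq \<Rightarrow> bool"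
  where "inexact_step n f \<psi> B \<sigma> x y p \<longleftrightarrow>
    y \<in> eff_dom n \<psi> \<and> p \<in> subdifferential n \<psi> y \<and>
    ereal (cubic_model n f B \<sigma> x y) + \<psi> y \<le> composite f \<psi> x \<and>
    norm (gradient n (cubic_model n f B \<sigma> x) y + p) \<le> \<sigma> / 4 * norm (y - x) ^ 2"

definition sufficient_decrease ::
  "(fseq \<Rightarrow> real) \<Rightarrow> (fseq \<Rightarrow> ereal) \<Rightarrow> real \<Rightarrow> real \<Rightarrow> fseq \<Rightarrow> nat \<Rightarrow> fseq \<Rightarrow> bool"
  where "sufficient_decrease f \<psi> \<sigma> \<epsilon> x0 t y \<longleftrightarrow>
    composite f \<psi> x0 - composite f \<psi> y
      \<ge> ereal (\<epsilon> powr (3/2) / (384 * \<sigma> powr (1/2)) * (real t + 1))"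

datatype outcome = Success | Solution | Halt

text \<open>\<open>cubic_loop n f \<psi> B \<sigma> m \<epsilon> x0 t xt y \<alpha> c\<close>: the loop of CubicSteps (started at x0), continued
  with counter t and current point xt, can return \<open>(y, \<alpha>)\<close> after c further oracle calls. It is a
  relation because the approximate minimizer is not unique. Each pass makes one call, at the new
  point; the call at the current point has been made before (at x0 by the caller).\<close>

inductive cubic_loop ::
  "nat \<Rightarrow> (fseq \<Rightarrow> real) \<Rightarrow> (fseq \<Rightarrow> ereal) \<Rightarrow> matr \<Rightarrow> real \<Rightarrow> nat \<Rightarrow> real \<Rightarrow> fseq
    \<Rightarrow> nat \<Rightarrow> fseq \<Rightarrow> fseq \<Rightarrow> outcome \<Rightarrow> nat \<Rightarrow> bool"
  for n f \<psi> B \<sigma> m \<epsilon> x0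
  where
    success: "cubic_loop n f \<psi> B \<sigma> m \<epsilon> x0 m xt xt Success 0"
  | solution: "\<lbrakk>t \<noteq> m; inexact_step n f \<psi> B \<sigma> xt y p; norm (gradient n f y + p) \<le> \<epsilon>\<rbrakk>
      \<Longrightarrow> cubic_loop n f \<psi> B \<sigma> m \<epsilon> x0 t xt y Solution 1"
  | continue: "\<lbrakk>t \<noteq> m; inexact_step n f \<psi> B \<sigma> xt y p; \<not> norm (gradient n f y + p) \<le> \<epsilon>;
        sufficient_decrease f \<psi> \<sigma> \<epsilon> x0 t y;
        cubic_loop n f \<psi> B \<sigma> m \<epsilon> x0 (Suc t) y z \<alpha> c\<rbrakk>
      \<Longrightarrow> cubic_loop n f \<psi> B \<sigma> m \<epsilon> x0 t xt z \<alpha> (Suc c)"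
  | halt: "\<lbrakk>t \<noteq> m; inexact_step n f \<psi> B \<sigma> xt y p; \<not> norm (gradient n f y + p) \<le> \<epsilon>;
        \<not> sufficient_decrease f \<psi> \<sigma> \<epsilon> x0 t y\<rbrakk>
      \<Longrightarrow> cubic_loop n f \<psi> B \<sigma> m \<epsilon> x0 t xt y Halt 1"

definition cubic_steps ::
  "nat \<Rightarrow> (fseq \<Rightarrow> real) \<Rightarrow> (fseq \<Rightarrow> ereal) \<Rightarrow> fseq \<Rightarrow> matr \<Rightarrow> real \<Rightarrow> nat \<Rightarrow> real
    \<Rightarrow> fseq \<Rightarrow> outcome \<Rightarrow> nat \<Rightarrow> bool"
  where "cubic_steps n f \<psi> x B \<sigma> m \<epsilon> y \<alpha> c \<longleftrightarrow> cubic_loop n f \<psi> B \<sigma> m \<epsilon> x 0 x y \<alpha> c"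

text \<open>In the following three definitions the argument T stands for the trial value
  \<open>2 ^ \<ell> * \<tau>\<^sub>k\<close>.\<close>

definition cnm_sigma :: "nat \<Rightarrow> real \<Rightarrow> real"
  where "cnm_sigma m T = 2 ^ 4 * (2/3) powr (1/3) * T * real m"

definition cnm_h :: "nat \<Rightarrow> nat \<Rightarrow> real \<Rightarrow> real \<Rightarrow> real"
  where "cnm_h n m \<epsilon> T =
    (3 * cnm_sigma m T powr (3/2) * \<epsilon> powr (3/2)
      / (2 ^ 7 * 192 * real n powr (3/2) * T ^ 3)) powr (1/3)"

definition fd_matrix :: "nat \<Rightarrow> (fseq \<Rightarrow> real) \<Rightarrow> fseq \<Rightarrow> real \<Rightarrow> matr"
  where "fd_matrix n f x h i j =
    coord ((gradient n f (x + h *\<^sub>R unit_vec j) - gradient n f x) /\<^sub>R h) i"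

definition cnm_B :: "nat \<Rightarrow> nat \<Rightarrow> (fseq \<Rightarrow> real) \<Rightarrow> real \<Rightarrow> fseq \<Rightarrow> real \<Rightarrow> matr"
  where "cnm_B n m f \<epsilon> x T i j =
    1/2 * (fd_matrix n f x (cnm_h n m \<epsilon> T) i j + fd_matrix n f x (cnm_h n m \<epsilon> T) j i)"

text \<open>The state before a trial: the current \<open>x\<^sub>k\<close>, \<open>\<tau>\<^sub>k\<close> and \<open>\<ell>\<close>, the number of oracle calls made so
  far, and whether the algorithm has stopped (then \<open>iterate\<close> is the last point generated).\<close>

record cnm_state =
  iterate :: fseq
  tau :: real
  ell :: nat
  calls :: nat
  stopped :: bool

text \<open>One trial. The finite differences take n + 1 oracle calls, at \<open>x\<^sub>k\<close> and at the n shifted points;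
  nothing is reused from earlier passes, so the count is an upper bound for any
  implementation that stores old values. Since \<open>\<ell> - 1\<close> may be negative, \<open>2 ^ (\<ell> - 1)\<close> is written
  \<open>2 ^ \<ell> / 2\<close>.\<close>

inductive cnm_step ::
  "nat \<Rightarrow> (fseq \<Rightarrow> real) \<Rightarrow> (fseq \<Rightarrow> ereal) \<Rightarrow> real \<Rightarrow> real \<Rightarrow> nat \<Rightarrow> cnm_state \<Rightarrow> cnm_state \<Rightarrow> bool"
  for n f \<psi> \<tau>0 \<epsilon> m
  where
    halt: "\<lbrakk>\<not> stopped s; T = 2 ^ ell s * tau s;
        cubic_steps n f \<psi> (iterate s) (cnm_B n m f \<epsilon> (iterate s) T) (cnm_sigma m T) m \<epsilon> y Halt c\<rbrakk>
      \<Longrightarrow> cnm_step n f \<psi> \<tau>0 \<epsilon> m s (s\<lparr>ell := Suc (ell s), calls := calls s + (n + 1) + c\<rparr>)"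
  | success: "\<lbrakk>\<not> stopped s; T = 2 ^ ell s * tau s;
        cubic_steps n f \<psi> (iterate s) (cnm_B n m f \<epsilon> (iterate s) T) (cnm_sigma m T) m \<epsilon> y Success c\<rbrakk>
      \<Longrightarrow> cnm_step n f \<psi> \<tau>0 \<epsilon> m s
            \<lparr>iterate = y, tau = max \<tau>0 (2 ^ ell s / 2 * tau s), ell = 0,
             calls = calls s + (n + 1) + c, stopped = False\<rparr>"
  | solution: "\<lbrakk>\<not> stopped s; T = 2 ^ ell s * tau s;
        cubic_steps n f \<psi> (iterate s) (cnm_B n m f \<epsilon> (iterate s) T) (cnm_sigma m T) m \<epsilon> y Solution c\<rbrakk>
      \<Longrightarrow> cnm_step n f \<psi> \<tau>0 \<epsilon> m s
            (s\<lparr>iterate := y, calls := calls s + (n + 1) + c, stopped := True\<rparr>)"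

definition cnm_init :: "fseq \<Rightarrow> real \<Rightarrow> cnm_state"
  where "cnm_init x0 \<tau>0 = \<lparr>iterate = x0, tau = \<tau>0, ell = 0, calls = 0, stopped = False\<rparr>"

text \<open>A complete run as an infinite sequence of states, which repeats the final state once the
  algorithm has stopped; a run that never stops is not excluded. The approximate minimizers
  requested by CubicSteps are taken to be supplied each time.\<close>

definition cnm_run ::
  "nat \<Rightarrow> (fseq \<Rightarrow> real) \<Rightarrow> (fseq \<Rightarrow> ereal) \<Rightarrow> fseq \<Rightarrow> real \<Rightarrow> real \<Rightarrow> nat \<Rightarrow> (nat \<Rightarrow> cnm_state) \<Rightarrow> bool"
  where "cnm_run n f \<psi> x0 \<tau>0 \<epsilon> m S \<longleftrightarrow>
    S 0 = cnm_init x0 \<tau>0 \<and>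
    (\<forall>i. if stopped (S i) then S (Suc i) = S i
         else cnm_step n f \<psi> \<tau>0 \<epsilon> m (S i) (S (Suc i)))"

end

theory Submission
  imports Defs
begin

text \<open>
  Write T for the trial value \<open>2 ^ \<ell> * \<tau>\<close>. If \<open>T \<ge> L\<close>, then the finite differences approximate the
  Hessian at \<open>x\<^sub>k\<close> within \<open>sqrt (\<sigma> \<epsilon>) / 40\<close>, and at a later point of CubicSteps, at distance D from
  \<open>x\<^sub>k\<close>, the error grows by \<open>L D\<close> only. A step of length r that misses the stationarity test forces r
  or \<open>D / n\<close> to be of order \<open>sqrt (\<epsilon> / \<sigma>)\<close>. Since D is at most the sum of the step lengths and
  \<open>\<sigma> \<ge> 13 n L\<close>, Young's inequality absorbs the drift terms into the cubic decrease summed over the at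
  most n steps. So CubicSteps does not halt once \<open>T \<ge> L\<close>, and T never exceeds \<open>max \<tau>\<^sub>0 (2 L)\<close>. A
  successful trial lowers the objective by a multiple of \<open>sqrt n * \<epsilon> powr (3/2)\<close>, which bounds the number of
  successful trials; a halted trial doubles T and a successful one at most halves it, which bounds the
  number of halted trials. Each trial costs at most \<open>2 n + 1\<close> oracle calls.
\<close>

section \<open>The Euclidean space inside the finitely supported sequences\<close>

lemma coord_unit_vec [simp]: "coord (unit_vec i) j = (if j = i then 1 else 0)"
  by (simp add: unit_vec_def coord_Abs)

lemma coord_sum [simp]: "coord (\<Sum>a\<in>A. g a) i = (\<Sum>a\<in>A. coord (g a) i)"
  by (induction A rule: infinite_finite_induct) auto

lemma inner_unit_vec [simp]: "inner x (unit_vec i) = coord x i"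
proof -
  have "inner (unit_vec i) x = (\<Sum>j\<in>{i}. coord (unit_vec i) j * coord x j)"
    by (rule inner_fseq_sum) auto
  then show ?thesis by (simp add: inner_commute)
qed

lemma norm_unit_vec [simp]: "norm (unit_vec i) = 1"
  by (simp add: norm_eq_sqrt_inner)

lemma Rn_zero [simp, intro]: "0 \<in> Rn n"
  and Rn_add [simp, intro]: "x \<in> Rn n \<Longrightarrow> y \<in> Rn n \<Longrightarrow> x + y \<in> Rn n"
  and Rn_diff [simp, intro]: "x \<in> Rn n \<Longrightarrow> y \<in> Rn n \<Longrightarrow> x - y \<in> Rn n"
  and Rn_scaleR [simp, intro]: "x \<in> Rn n \<Longrightarrow> c *\<^sub>R x \<in> Rn n"
  and Rn_unit_vec [simp, intro]: "i < n \<Longrightarrow> unit_vec i \<in> Rn n"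
  by (auto simp: Rn_def)

lemma inner_Rn: "x \<in> Rn n \<Longrightarrow> inner x y = (\<Sum>i<n. coord x i * coord y i)"
  by (rule inner_fseq_sum) (auto simp: Rn_def not_le[symmetric])

lemma coord_mat_vec: "coord (mat_vec n A v) i = (if i < n then \<Sum>j<n. A i j * coord v j else 0)"
  by (auto simp: mat_vec_def if_distrib[of "(*) _"] cong: if_cong)

lemma Rn_mat_vec [simp, intro]: "mat_vec n A v \<in> Rn n"
  by (simp add: Rn_def coord_mat_vec)

lemma mat_vec_unit_vec: "i < n \<Longrightarrow> j < n \<Longrightarrow> coord (mat_vec n A (unit_vec j)) i = A i j"
  by (simp add: coord_mat_vec if_distrib[of "(*) _"] cong: if_cong)

lemma mat_vec_diff_left: "mat_vec n (\<lambda>i j. A i j - B i j) v = mat_vec n A v - mat_vec n B v"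
  by (rule fseq_eqI) (simp add: coord_mat_vec algebra_simps sum_subtractf)

lemma bounded_linear_mat_vec: "bounded_linear (mat_vec n A)"
proof -
  have "mat_vec n A = (\<lambda>v. \<Sum>i<n. (\<Sum>j<n. A i j * inner v (unit_vec j)) *\<^sub>R unit_vec i)"
    by (simp add: mat_vec_def fun_eq_iff)
  moreover have "bounded_linear \<dots>"
    by (intro bounded_linear_intros)
  ultimately show ?thesis by simp
qed

lemmas mat_vec_scaleR = linear_scale[OF bounded_linear.linear[OF bounded_linear_mat_vec]]
  and mat_vec_add = linear_add[OF bounded_linear.linear[OF bounded_linear_mat_vec]]

lemma inner_mat_vec_transpose:
  assumes "v \<in> Rn n" "w \<in> Rn n"
  shows "inner (mat_vec n (\<lambda>i j. A j i) v) w = inner v (mat_vec n A w)"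
proof -
  have "inner (mat_vec n (\<lambda>i j. A j i) v) w = (\<Sum>i<n. \<Sum>j<n. A j i * coord v j * coord w i)"
    by (simp add: inner_Rn[OF Rn_mat_vec] coord_mat_vec sum_distrib_right)
  also have "\<dots> = (\<Sum>j<n. \<Sum>i<n. A j i * coord v j * coord w i)"
    by (rule sum.swap)
  also have "\<dots> = inner v (mat_vec n A w)"
    by (simp add: inner_Rn[OF assms(1)] coord_mat_vec sum_distrib_left mult_ac)
  finally show ?thesis .
qed

text \<open>Cauchy-Schwarz against the all-ones vector of length n. As \<open>v\<close> may have
  support beyond n, the squares are summed over an index set containing both \<open>{..<n}\<close>
  and the support.\<close>

lemma sum_abs_coord_le: "(\<Sum>j<n. \<bar>coord v j\<bar>) \<le> sqrt (real n) * norm v"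
proof -
  define I where "I = {..<n} \<union> {i. coord v i \<noteq> 0}"
  have "(\<Sum>j<n. (coord v j)\<^sup>2) \<le> (\<Sum>j\<in>I. (coord v j)\<^sup>2)"
    by (rule sum_mono2) (auto simp: I_def finite_support)
  also have "\<dots> = (norm v)\<^sup>2"
    unfolding power2_norm_eq_inner power2_eq_square[of "coord _ _"]
    by (rule inner_fseq_sum[symmetric]) (auto simp: I_def finite_support)
  finally have "real n * (\<Sum>j<n. (coord v j)\<^sup>2) \<le> real n * (norm v)\<^sup>2"
    by (rule mult_left_mono) simp
  moreover have "(\<Sum>j<n. \<bar>coord v j\<bar>)\<^sup>2 \<le> real n * (\<Sum>j<n. (coord v j)\<^sup>2)"
    using sum_squared_le_sum_of_squares[of "\<lambda>j. \<bar>coord v j\<bar>" "{..<n}"] by (simp add: mult.commute)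
  ultimately have "(\<Sum>j<n. \<bar>coord v j\<bar>)\<^sup>2 \<le> real n * (norm v)\<^sup>2"
    by linarith
  also have "\<dots> = (sqrt (real n) * norm v)\<^sup>2"
    by (simp add: power_mult_distrib)
  finally show ?thesis
    by (rule power2_le_imp_le) simp
qed

text \<open>Expanding \<open>v\<close> in the unit vectors costs the l1 norm of its coordinates,
  hence the square root of n. This turns columnwise finite difference errors into an operator
  bound.\<close>

lemma norm_mat_vec_columns:
  assumes "\<And>j. j < n \<Longrightarrow> norm (mat_vec n A (unit_vec j)) \<le> b"
  shows "norm (mat_vec n A v) \<le> sqrt (real n) * b * norm v"
proof (cases "n = 0")
  case True
  then show ?thesis by (simp add: mat_vec_def)
next
  case False
  have "0 \<le> b"
    using assms[of 0] False norm_ge_zero[of "mat_vec n A (unit_vec 0)"] by linarith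
  have "mat_vec n A v = (\<Sum>j<n. coord v j *\<^sub>R mat_vec n A (unit_vec j))"
    by (rule fseq_eqI) (auto simp: coord_mat_vec mat_vec_unit_vec mult.commute
        if_distrib[of "(*) _"] cong: if_cong)
  also have "norm \<dots> \<le> (\<Sum>j<n. \<bar>coord v j\<bar> * b)"
    by (rule sum_norm_le) (use assms in \<open>auto intro: mult_left_mono\<close>)
  also have "\<dots> = (\<Sum>j<n. \<bar>coord v j\<bar>) * b"
    by (simp add: sum_distrib_right)
  also have "\<dots> \<le> sqrt (real n) * norm v * b"
    by (rule mult_right_mono[OF sum_abs_coord_le \<open>0 \<le> b\<close>])
  finally show ?thesis by (simp add: mult_ac)
qed

text \<open>Pairing the image \<open>w\<close> with itself moves the matrix to the other factor: <w,
  w> = <v, A w>, which is at most b |v| |w|.\<close>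

lemma norm_mat_vec_transpose:
  assumes "\<And>v. norm (mat_vec n A v) \<le> b * norm v" "v \<in> Rn n"
  shows "norm (mat_vec n (\<lambda>i j. A j i) v) \<le> b * norm v"
proof -
  define w where "w = mat_vec n (\<lambda>i j. A j i) v"
  have "norm w * norm w = inner w w"
    by (simp add: power2_norm_eq_inner[symmetric] power2_eq_square)
  also have "\<dots> = inner v (mat_vec n A w)"
    unfolding w_def by (rule inner_mat_vec_transpose) (use assms in auto)
  also have "\<dots> \<le> norm v * norm (mat_vec n A w)"
    by (rule norm_cauchy_schwarz)
  also have "\<dots> \<le> norm v * (b * norm w)"
    by (rule mult_left_mono[OF assms(1)]) simp
  finally have "norm w * norm w \<le> (b * norm v) * norm w"
    by (simp add: mult_ac)
  \<comment> \<open>Settles the case \<open>w = 0\<close>, where \<open>norm w\<close> cannot be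
    cancelled.\<close>
  moreover have "0 \<le> b * norm v"
    using assms(1)[of v] norm_ge_zero order_trans by blast
  ultimately show ?thesis
    unfolding w_def[symmetric]
    by (metis mult_right_le_imp_le norm_ge_zero order_le_less)
qed

section \<open>Gradients and Hessians\<close>

text \<open>The line through \<open>x\<close> with a direction from \<open>Rn n\<close> stays in
  \<open>Rn n\<close>, so a derivative within this subspace yields an ordinary derivative in one
  real variable.\<close>

lemma has_vector_derivative_line:
  assumes "(F has_derivative D) (at (x + t *\<^sub>R s) within Rn n)" "x \<in> Rn n" "s \<in> Rn n"
  shows "((\<lambda>u. F (x + u *\<^sub>R s)) has_vector_derivative D s) (at t)"
proof -
  have "((\<lambda>u. x + u *\<^sub>R s) has_derivative (\<lambda>u. u *\<^sub>R s)) (at t)"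
    by (auto intro!: derivative_eq_intros)
  moreover have "(F has_derivative D) (at (x + t *\<^sub>R s) within range (\<lambda>u. x + u *\<^sub>R s))"
    using assms by (intro has_derivative_subset[OF assms(1)]) auto
  ultimately have "((\<lambda>u. F (x + u *\<^sub>R s)) has_derivative (\<lambda>u. D (u *\<^sub>R s))) (at t)"
    by (rule has_derivative_in_compose)
  then show ?thesis
    using assms(1) by (simp add: has_vector_derivative_def has_derivative_def
        linear_scale[OF bounded_linear.linear])
qed

text \<open>\<open>Rn n\<close> has empty interior in \<open>fseq\<close>, so a derivative within it
  is determined only on directions from \<open>Rn n\<close>; these values are read off
  lines.\<close>

lemma has_derivative_within_Rn_unique:
  assumes "(F has_derivative D) (at x within Rn n)" "(F has_derivative D') (at x within Rn n)"
    and "x \<in> Rn n" "s \<in> Rn n"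
  shows "D s = D' s"
  using has_vector_derivative_line[of F D x 0 s n] has_vector_derivative_line[of F D' x 0 s n] assms
  by (auto intro: vector_derivative_unique_at)

lemma gradient_eq:
  assumes "has_gradient n f g x" "x \<in> Rn n"
  shows "gradient n f x = g"
  unfolding gradient_def
proof (rule the_equality)
  fix g' assume g': "has_gradient n f g' x"
  have "inner g' v = inner g v" if "v \<in> Rn n" for v
    using has_derivative_within_Rn_unique[of f _ x n _ v] assms g' that
    unfolding has_gradient_def by blast
  \<comment> \<open>\<open>has_gradient\<close> puts both candidates into \<open>Rn n\<close>, so
    their difference is an admissible direction.\<close>
  from this[of "g' - g"] have "inner (g' - g) (g' - g) = 0"
    using assms g' by (simp add: has_gradient_def inner_diff_left)
  then show "g' = g" by simp
qed (use assms in simp)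

text \<open>Inside the n-by-n block the entries come from the derivative at unit vectors; outside it
  \<open>has_hessian\<close> normalizes them to 0.\<close>

lemma hessian_eq:
  assumes "has_hessian n f H x" "x \<in> Rn n"
  shows "hessian n f x = H"
  unfolding hessian_def
proof (rule the_equality)
  fix H' assume H': "has_hessian n f H' x"
  have "H' i j = H i j" for i j
  proof (cases "i < n \<and> j < n")
    case True
    then have "mat_vec n H' (unit_vec j) = mat_vec n H (unit_vec j)"
      using has_derivative_within_Rn_unique[of "gradient n f" _ x n _ "unit_vec j"] assms H'
      unfolding has_hessian_def by blast
    then show ?thesis
      using True by (metis mat_vec_unit_vec)
  next
    case False
    then show ?thesis
      using assms(1) H' unfolding has_hessian_def by (metis not_less)
  qed
  then show "H' = H" by (intro ext)
qed (use assms in simp)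

text \<open>The norm need not be differentiable at 0, so \<open>y = x\<close> is handled by the
  difference quotient, which is a squared norm tending to 0; elsewhere the power rule
  applies.\<close>

lemma has_derivative_norm_cube:
  fixes x y :: "'a :: real_inner"
  shows "((\<lambda>z. norm (z - x) ^ 3) has_derivative (\<lambda>v. inner ((3 * norm (y - x)) *\<^sub>R (y - x)) v))
    (at y within S)"
proof (cases "y = x")
  case True
  have "((\<lambda>z. norm (z - x) ^ 3 / norm (z - x)) \<longlongrightarrow> 0) (at x within S)"
  proof (rule Lim_transform_eventually)
    show "((\<lambda>z. norm (z - x) ^ 2) \<longlongrightarrow> 0) (at x within S)"
      by (auto intro!: tendsto_eq_intros)
    show "\<forall>\<^sub>F z in at x within S. norm (z - x) ^ 2 = norm (z - x) ^ 3 / norm (z - x)"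
      by (auto simp: eventually_at_filter power2_eq_square power3_eq_cube)
  qed
  then show ?thesis
    using True by (simp add: has_derivative_iff_norm divide_inverse mult_ac)
next
  case False
  have "((\<lambda>z. z - x) has_derivative (\<lambda>v. v)) (at y within S)"
    by (auto intro!: derivative_eq_intros)
  then have "((\<lambda>z. norm (z - x)) has_derivative (\<lambda>v. inner (sgn (y - x)) v)) (at y within S)"
    using has_derivative_compose[of "\<lambda>z. z - x" "\<lambda>v. v" y S norm "\<lambda>v. inner v (sgn (y - x))"]
      has_derivative_norm[of "y - x"] False
    by (simp add: inner_commute[of "sgn (y - x)"])
  from has_derivative_power[OF this, of 3]
  show ?thesis
    using False by (elim has_derivative_eq_rhs)
      (auto simp: fun_eq_iff sgn_div_norm power2_eq_square divide_inverse)
qed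

text \<open>The difference quotient sees only increments from \<open>Rn n\<close>, so the linear map
  may be changed off this subspace.\<close>

lemma has_derivative_within_Rn_cong:
  assumes "(F has_derivative D) (at x within Rn n)" "x \<in> Rn n"
    and "bounded_linear D'" "\<And>v. v \<in> Rn n \<Longrightarrow> D v = D' v"
  shows "(F has_derivative D') (at x within Rn n)"
proof -
  have "\<forall>\<^sub>F y in at x within Rn n. norm (F y - F x - D (y - x)) / norm (y - x)
      = norm (F y - F x - D' (y - x)) / norm (y - x)"
    using assms(2,4) by (auto simp: eventually_at_filter)
  then show ?thesis
    using assms(1,3) unfolding has_derivative_iff_norm by (auto elim: Lim_transform_eventually)
qed

text \<open>Symmetry of \<open>B\<close> makes the two halves of the derivative of the quadratic
  form equal. This is checked on \<open>Rn n\<close>, which is enough for a derivative within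
  \<open>Rn n\<close>.\<close>

lemma gradient_cubic_model:
  assumes "has_gradient n f (gradient n f x) x" "\<And>i j. B i j = B j i" "x \<in> Rn n" "y \<in> Rn n"
  shows "gradient n (cubic_model n f B \<sigma> x) y =
    gradient n f x + mat_vec n B (y - x) + (\<sigma> / 2 * norm (y - x)) *\<^sub>R (y - x)"
proof (rule gradient_eq[OF _ assms(4)])
  define g where "g = gradient n f x"
  let ?G = "g + mat_vec n B (y - x) + (\<sigma> / 2 * norm (y - x)) *\<^sub>R (y - x)"
  have g: "g \<in> Rn n"
    using assms(1) by (simp add: has_gradient_def g_def)
  note bounded_linear.has_derivative[OF bounded_linear_mat_vec, derivative_intros]
  have quadr: "((\<lambda>z. inner (mat_vec n B (z - x)) (z - x)) has_derivative
      (\<lambda>v. inner (mat_vec n B (y - x)) v + inner (mat_vec n B v) (y - x))) (at y within Rn n)"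
    by (auto intro!: derivative_eq_intros)
  have "(cubic_model n f B \<sigma> x has_derivative (\<lambda>v. 0 + inner g v
      + 1/2 * (inner (mat_vec n B (y - x)) v + inner (mat_vec n B v) (y - x))
      + \<sigma> / 6 * inner ((3 * norm (y - x)) *\<^sub>R (y - x)) v)) (at y within Rn n)"
    unfolding cubic_model_def g_def[symmetric]
    by (intro has_derivative_add has_derivative_mult_right has_derivative_norm_cube quadr
        has_derivative_const) (auto intro!: derivative_eq_intros)
  moreover have "0 + inner g v
      + 1/2 * (inner (mat_vec n B (y - x)) v + inner (mat_vec n B v) (y - x))
      + \<sigma> / 6 * inner ((3 * norm (y - x)) *\<^sub>R (y - x)) v = inner ?G v" if "v \<in> Rn n" for v
  proof -
    have "(\<lambda>i j. B j i) = B"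
      using assms(2) by blast
    then have "inner (mat_vec n B v) (y - x) = inner (mat_vec n B (y - x)) v"
      using inner_mat_vec_transpose[of v n "y - x" B] assms(3,4) that
      by (simp add: inner_commute[of v])
    then show ?thesis by (simp add: inner_add_left)
  qed
  ultimately have "(cubic_model n f B \<sigma> x has_derivative inner ?G) (at y within Rn n)"
    using assms(4) by (auto intro: has_derivative_within_Rn_cong bounded_linear_inner_right)
  then show "has_gradient n (cubic_model n f B \<sigma> x) (gradient n f x + mat_vec n B (y - x) +
      (\<sigma> / 2 * norm (y - x)) *\<^sub>R (y - x)) y"
    using g assms(3,4) by (simp add: has_gradient_def g_def)
qed

section \<open>Taylor estimates and symmetry of the Hessian\<close>

locale lipschitz_hessian =
  fixes n :: nat and f :: "fseq \<Rightarrow> real" and L :: real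
  assumes C2: "C2 n f" and lipschitz: "hessian_lipschitz n f L"
begin

abbreviation "grad \<equiv> gradient n f"
abbreviation "Hess x \<equiv> mat_vec n (hessian n f x)"

lemma has_gradient_grad: "x \<in> Rn n \<Longrightarrow> has_gradient n f (grad x) x"
  using C2 gradient_eq unfolding C2_def by metis

lemma grad_Rn [simp, intro]: "x \<in> Rn n \<Longrightarrow> grad x \<in> Rn n"
  using has_gradient_grad by (simp add: has_gradient_def)

lemma has_hessian_hessian: "x \<in> Rn n \<Longrightarrow> has_hessian n f (hessian n f x) x"
  using C2 hessian_eq unfolding C2_def by metis

lemma Hess_lipschitz:
  assumes "x \<in> Rn n" "y \<in> Rn n"
  shows "norm (Hess y v - Hess x v) \<le> L * norm (y - x) * norm v"
proof -
  have "norm (Hess y v - Hess x v)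
      \<le> spectral_norm n (\<lambda>i j. hessian n f y i j - hessian n f x i j) * norm v"
    unfolding spectral_norm_def mat_vec_diff_left[symmetric]
    by (rule onorm[OF bounded_linear_mat_vec])
  also have "\<dots> \<le> L * norm (y - x) * norm v"
    using lipschitz assms by (intro mult_right_mono) (auto simp: hessian_lipschitz_def)
  finally show ?thesis .
qed

lemma DERIV_grad_line:
  assumes "x \<in> Rn n" "s \<in> Rn n"
  shows "((\<lambda>u. inner (grad (x + u *\<^sub>R s)) v) has_real_derivative inner (Hess (x + t *\<^sub>R s) s) v) (at t)"
proof -
  have "((\<lambda>u. grad (x + u *\<^sub>R s)) has_vector_derivative Hess (x + t *\<^sub>R s) s) (at t)"
    using has_hessian_hessian[of "x + t *\<^sub>R s"] assms
    by (intro has_vector_derivative_line) (auto simp: has_hessian_def)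
  then show ?thesis
    unfolding has_real_derivative_iff_has_vector_derivative
    by (rule bounded_linear.has_vector_derivative[OF bounded_linear_inner_left])
qed

lemma DERIV_line:
  assumes "x \<in> Rn n" "s \<in> Rn n"
  shows "((\<lambda>u. f (x + u *\<^sub>R s)) has_real_derivative inner (grad (x + t *\<^sub>R s)) s) (at t)"
proof -
  have "(f has_derivative inner (grad (x + t *\<^sub>R s))) (at (x + t *\<^sub>R s) within Rn n)"
    using has_gradient_grad[of "x + t *\<^sub>R s"] assms by (auto simp: has_gradient_def)
  from has_vector_derivative_line[OF this assms] show ?thesis
    unfolding has_real_derivative_iff_has_vector_derivative .
qed

text \<open>The remainder \<open>v\<close> serves as its own test vector: paired with
  \<open>v\<close>, the gradient along the segment grows no faster than its quadratic bound, and at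
  the endpoint this reads |v|^2 \<le> L / 2 |s|^2 |v|.\<close>

lemma grad_taylor:
  assumes "x \<in> Rn n" "s \<in> Rn n"
  shows "norm (grad (x + s) - grad x - Hess x s) \<le> L / 2 * norm s ^ 2"
proof -
  define v where "v = grad (x + s) - grad x - Hess x s"
  define \<phi> where "\<phi> t = inner (grad (x + t *\<^sub>R s)) v - t * inner (Hess x s) v
    - L / 2 * t\<^sup>2 * norm s ^ 2 * norm v" for t
  have "\<phi> 1 \<le> \<phi> 0"
  proof (rule DERIV_nonpos_imp_nonincreasing[of 0 1 \<phi>])
    fix t :: real assume t: "0 \<le> t" "t \<le> 1"
    let ?d = "inner (Hess (x + t *\<^sub>R s) s) v - inner (Hess x s) v - L * t * norm s ^ 2 * norm v"
    have "(\<phi> has_real_derivative ?d) (at t)"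
      unfolding \<phi>_def by (auto intro!: derivative_eq_intros DERIV_grad_line[OF assms])
    moreover have "inner (Hess (x + t *\<^sub>R s) s) v - inner (Hess x s) v
        \<le> norm (Hess (x + t *\<^sub>R s) s - Hess x s) * norm v"
      by (metis inner_diff_left norm_cauchy_schwarz)
    moreover have "\<dots> \<le> (L * norm (x + t *\<^sub>R s - x) * norm s) * norm v"
      by (intro mult_right_mono Hess_lipschitz) (use assms in auto)
    moreover have "\<dots> = L * t * norm s ^ 2 * norm v"
      using t by (simp add: power2_eq_square)
    ultimately show "\<exists>d. (\<phi> has_real_derivative d) (at t) \<and> d \<le> 0"
      by (intro exI[of _ ?d]) linarith
  qed simp
  then have "inner v v \<le> L / 2 * norm s ^ 2 * norm v"
    by (simp add: \<phi>_def v_def inner_diff_left)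
  then have "norm v * norm v \<le> (L / 2 * norm s ^ 2) * norm v"
    by (simp add: power2_norm_eq_inner[symmetric] power2_eq_square)
  \<comment> \<open>The locale fixes no sign for \<open>L\<close>; the Lipschitz estimate itself
    makes this product nonnegative, which covers \<open>v = 0\<close>.\<close>
  moreover have "0 \<le> L / 2 * norm s ^ 2"
    using order_trans[OF norm_ge_zero Hess_lipschitz[of x "x + s" s]] assms
    by (simp add: power2_eq_square)
  ultimately show ?thesis
    unfolding v_def[symmetric] by (metis mult_right_le_imp_le norm_ge_zero order_le_less)
qed

text \<open>The derivative of the remainder along the segment is the remainder of
  \<open>grad_taylor\<close> paired with \<open>s\<close>.\<close>

lemma taylor:
  assumes "x \<in> Rn n" "s \<in> Rn n"
  shows "f (x + s) \<le> f x + inner (grad x) s + 1/2 * inner (Hess x s) s + L / 6 * norm s ^ 3"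
proof -
  define \<phi> where "\<phi> t = f (x + t *\<^sub>R s) - t * inner (grad x) s - t\<^sup>2 / 2 * inner (Hess x s) s
    - L / 6 * t ^ 3 * norm s ^ 3" for t
  have "\<phi> 1 \<le> \<phi> 0"
  proof (rule DERIV_nonpos_imp_nonincreasing[of 0 1 \<phi>])
    fix t :: real
    let ?d = "inner (grad (x + t *\<^sub>R s)) s - inner (grad x) s - t * inner (Hess x s) s
      - L / 2 * t\<^sup>2 * norm s ^ 3"
    have "(\<phi> has_real_derivative ?d) (at t)"
      unfolding \<phi>_def by (auto intro!: derivative_eq_intros DERIV_line[OF assms])
    moreover have "inner (grad (x + t *\<^sub>R s)) s - inner (grad x) s - t * inner (Hess x s) s
        \<le> norm (grad (x + t *\<^sub>R s) - grad x - Hess x (t *\<^sub>R s)) * norm s"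
      using norm_cauchy_schwarz[of "grad (x + t *\<^sub>R s) - grad x - Hess x (t *\<^sub>R s)" s]
      by (simp add: inner_diff_left mat_vec_scaleR)
    moreover have "\<dots> \<le> (L / 2 * norm (t *\<^sub>R s) ^ 2) * norm s"
      by (intro mult_right_mono grad_taylor) (use assms in auto)
    moreover have "\<dots> = L / 2 * t\<^sup>2 * norm s ^ 3"
      by (simp add: power_mult_distrib power2_eq_square power3_eq_cube)
    ultimately show "\<exists>d. (\<phi> has_real_derivative d) (at t) \<and> d \<le> 0"
      by (intro exI[of _ ?d]) linarith
  qed simp
  then show ?thesis
    by (simp add: \<phi>_def)
qed

text \<open>The quantity is the increment of \<phi> over [0, 1]. By the mean value theorem it equals
  a derivative, in which the gradient expansions for the increments u + t v and t v leave only their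
  remainders \<open>a\<close> and \<open>b\<close>.\<close>

lemma second_difference:
  assumes "x \<in> Rn n" "u \<in> Rn n" "v \<in> Rn n"
  shows "\<bar>f (x + u + v) - f (x + u) - f (x + v) + f x - inner (Hess x u) v\<bar>
    \<le> \<bar>L\<bar> * (norm u + norm v) ^ 3"
proof -
  define \<phi> where "\<phi> t = f ((x + u) + t *\<^sub>R v) - f (x + t *\<^sub>R v) - t * inner (Hess x u) v" for t
  define \<phi>' where "\<phi>' t = inner (grad ((x + u) + t *\<^sub>R v)) v - inner (grad (x + t *\<^sub>R v)) v
    - inner (Hess x u) v" for t
  have "(\<phi> has_real_derivative \<phi>' t) (at t)" for t
    unfolding \<phi>_def \<phi>'_def
    by (auto intro!: derivative_eq_intros DERIV_line assms)
  then obtain t where t: "0 < t" "t < 1" "\<phi> 1 - \<phi> 0 = \<phi>' t"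
    using MVT2[of 0 1 \<phi> \<phi>'] by auto
  define a where "a = grad (x + (u + t *\<^sub>R v)) - grad x - Hess x (u + t *\<^sub>R v)"
  define b where "b = grad (x + t *\<^sub>R v) - grad x - Hess x (t *\<^sub>R v)"
  have tv: "norm (t *\<^sub>R v) \<le> norm v"
    using t mult_right_mono[of t 1 "norm v"] by simp
  have "norm a \<le> L / 2 * norm (u + t *\<^sub>R v) ^ 2" "norm b \<le> L / 2 * norm (t *\<^sub>R v) ^ 2"
    unfolding a_def b_def by (rule grad_taylor; use assms in auto)+
  moreover have "L / 2 * norm (u + t *\<^sub>R v) ^ 2 \<le> \<bar>L\<bar> / 2 * (norm u + norm v) ^ 2"
    using tv norm_triangle_ineq[of u "t *\<^sub>R v"] by (intro mult_mono power_mono) auto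
  moreover have "L / 2 * norm (t *\<^sub>R v) ^ 2 \<le> \<bar>L\<bar> / 2 * (norm u + norm v) ^ 2"
    using tv by (intro mult_mono power_mono) (auto intro: add_increasing)
  ultimately have "norm (a - b) \<le> \<bar>L\<bar> * (norm u + norm v) ^ 2"
    using norm_triangle_ineq4[of a b] by linarith
  moreover have "\<phi>' t = inner (a - b) v"
    by (simp add: \<phi>'_def a_def b_def inner_diff_left inner_add_left mat_vec_add add.assoc)
  then have "\<bar>\<phi>' t\<bar> \<le> norm (a - b) * norm v"
    using Cauchy_Schwarz_ineq2 by metis
  ultimately have "\<bar>\<phi>' t\<bar> \<le> \<bar>L\<bar> * (norm u + norm v) ^ 2 * (norm u + norm v)"
    by (elim order_trans) (intro mult_mono, auto)
  moreover have "\<phi> 1 - \<phi> 0 = f (x + u + v) - f (x + u) - f (x + v) + f x - inner (Hess x u) v"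
    by (simp add: \<phi>_def)
  ultimately show ?thesis
    using t(3) by (simp add: power2_eq_square power3_eq_cube mult.assoc)
qed

text \<open>The second difference is symmetric in its two increments, so its quadratic part is as well.\<close>

lemma inner_Hess_symmetric:
  assumes "x \<in> Rn n" "u \<in> Rn n" "v \<in> Rn n"
  shows "inner (Hess x u) v = inner (Hess x v) u"
proof (rule ccontr)
  define d where "d = \<bar>inner (Hess x u) v - inner (Hess x v) u\<bar>"
  define c where "c = 2 * \<bar>L\<bar> * (norm u + norm v) ^ 3"
  assume "inner (Hess x u) v \<noteq> inner (Hess x v) u"
  then have "d > 0" by (simp add: d_def)
  have "c \<ge> 0" by (simp add: c_def)
  \<comment> \<open>Scaling both increments by \<open>t\<close> scales the asymmetry by t^2 but the
    error by t^3.\<close>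
  have le: "d \<le> c * t" if "t > 0" for t
  proof -
    define a b where "a = t *\<^sub>R u" and "b = t *\<^sub>R v"
    define D where "D = f (x + a + b) - f (x + a) - f (x + b) + f x"
    have ab: "a \<in> Rn n" "b \<in> Rn n"
      using assms by (simp_all add: a_def b_def)
    have "\<bar>D - inner (Hess x a) b\<bar> \<le> \<bar>L\<bar> * (norm a + norm b) ^ 3"
      unfolding D_def by (rule second_difference) (use assms ab in auto)
    moreover have "\<bar>D - inner (Hess x b) a\<bar> \<le> \<bar>L\<bar> * (norm a + norm b) ^ 3"
    proof -
      have "D = f (x + b + a) - f (x + b) - f (x + a) + f x"
        by (simp add: D_def add_ac)
      then show ?thesis
        using second_difference[OF assms(1) ab(2) ab(1)] by (simp only: add.commute[of "norm b"])
    qed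
    moreover have "inner (Hess x a) b - inner (Hess x b) a
        = t\<^sup>2 * (inner (Hess x u) v - inner (Hess x v) u)"
      by (simp add: a_def b_def mat_vec_scaleR power2_eq_square right_diff_distrib)
    moreover have nab: "norm a + norm b = t * (norm u + norm v)"
      using that by (simp add: a_def b_def distrib_left)
    ultimately have "\<bar>t\<^sup>2 * (inner (Hess x u) v - inner (Hess x v) u)\<bar>
        \<le> 2 * (\<bar>L\<bar> * (t * (norm u + norm v)) ^ 3)"
      unfolding nab by linarith
    also have "\<dots> = t\<^sup>2 * (c * t)"
      by (simp add: c_def power_mult_distrib power2_eq_square power3_eq_cube)
    finally have "t\<^sup>2 * d \<le> t\<^sup>2 * (c * t)"
      by (simp add: d_def abs_mult)
    then show ?thesis
      using that by simp
  qed
  \<comment> \<open>This choice makes \<open>c * t\<close> smaller than \<open>d\<close>; the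
    summand 1 keeps the denominator positive when \<open>c = 0\<close>.\<close>
  from le[of "d / (2 * (c + 1))"] have "d * (2 * (c + 1)) \<le> c * d"
    using \<open>d > 0\<close> \<open>c \<ge> 0\<close> by (simp add: field_simps)
  then have "2 * (c + 1) \<le> c"
    using \<open>d > 0\<close> by (simp add: mult.commute)
  then show False
    using \<open>c \<ge> 0\<close> by simp
qed

lemma hessian_symmetric:
  assumes "x \<in> Rn n"
  shows "hessian n f x i j = hessian n f x j i"
proof (cases "i < n \<and> j < n")
  case True
  then show ?thesis
    using inner_Hess_symmetric[OF assms, of "unit_vec j" "unit_vec i"]
    by (simp add: mat_vec_unit_vec)
next
  case False
  then show ?thesis
    using has_hessian_hessian[OF assms] by (auto simp: has_hessian_def not_less)
qed

section \<open>Finite difference approximation of the Hessian\<close>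

lemma norm_fd_matrix_diff:
  assumes "x \<in> Rn n" "h > 0"
  shows "norm (mat_vec n (\<lambda>i j. fd_matrix n f x h i j - hessian n f x i j) v)
    \<le> sqrt (real n) * (L * h / 2) * norm v"
proof (rule norm_mat_vec_columns)
  fix j assume j: "j < n"
  \<comment> \<open>Column j of the error is this Taylor remainder divided by \<open>h\<close>; the
    remainder is of order h^2, the column of order h.\<close>
  define w where "w = grad (x + h *\<^sub>R unit_vec j) - grad x - Hess x (h *\<^sub>R unit_vec j)"
  have "w \<in> Rn n"
    using assms j by (auto simp: w_def)
  have "mat_vec n (\<lambda>i j. fd_matrix n f x h i j - hessian n f x i j) (unit_vec j) = w /\<^sub>R h"
  proof (rule fseq_eqI)
    fix i
    show "coord (mat_vec n (\<lambda>i j. fd_matrix n f x h i j - hessian n f x i j) (unit_vec j)) i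
        = coord (w /\<^sub>R h) i"
    proof (cases "i < n")
      case True
      then show ?thesis
        using j assms by (simp add: w_def mat_vec_unit_vec mat_vec_scaleR fd_matrix_def field_simps)
    next
      case False
      then show ?thesis
        using \<open>w \<in> Rn n\<close> by (simp add: Rn_def coord_mat_vec)
    qed
  qed
  moreover have "norm w \<le> L / 2 * norm (h *\<^sub>R unit_vec j) ^ 2"
    unfolding w_def by (rule grad_taylor) (use assms j in auto)
  then have "norm w \<le> (L * h / 2) * h"
    using assms by (simp add: power2_eq_square)
  then have "norm w / h \<le> L * h / 2"
    using assms by (simp add: pos_divide_le_eq)
  moreover have "norm (w /\<^sub>R h) = norm w / h"
    using assms by (simp add: field_simps)
  ultimately show "norm (mat_vec n (\<lambda>i j. fd_matrix n f x h i j - hessian n f x i j) (unit_vec j))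
      \<le> L * h / 2"
    by simp
qed

text \<open>As the Hessian is symmetric, the error of the symmetrized matrix is the average of the
  finite difference error and its transpose, and both obey the same operator bound.\<close>

lemma norm_cnm_B_diff:
  assumes "x \<in> Rn n" "cnm_h n m \<epsilon> T > 0" "v \<in> Rn n"
  shows "norm (mat_vec n (cnm_B n m f \<epsilon> x T) v - Hess x v)
    \<le> sqrt (real n) * (L * cnm_h n m \<epsilon> T / 2) * norm v"
proof -
  define E where "E = (\<lambda>i j. fd_matrix n f x (cnm_h n m \<epsilon> T) i j - hessian n f x i j)"
  define b where "b = sqrt (real n) * (L * cnm_h n m \<epsilon> T / 2)"
  have "mat_vec n (cnm_B n m f \<epsilon> x T) v - Hess x v
      = (1/2) *\<^sub>R (mat_vec n E v + mat_vec n (\<lambda>i j. E j i) v)"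
    by (rule fseq_eqI)
       (simp add: coord_mat_vec cnm_B_def E_def hessian_symmetric[OF assms(1)] mult.assoc distrib_right
        left_diff_distrib add_divide_distrib diff_divide_distrib sum.distrib sum_subtractf sum_divide_distrib[symmetric])
  moreover have E: "norm (mat_vec n E w) \<le> b * norm w" for w
    unfolding E_def b_def by (rule norm_fd_matrix_diff[OF assms(1,2)])
  moreover have "norm (mat_vec n (\<lambda>i j. E j i) v) \<le> b * norm v"
    by (rule norm_mat_vec_transpose[OF E assms(3)])
  then have "norm (mat_vec n E v + mat_vec n (\<lambda>i j. E j i) v) \<le> 2 * (b * norm v)"
    using norm_triangle_ineq[of "mat_vec n E v" "mat_vec n (\<lambda>i j. E j i) v"] E[of v] by linarith
  ultimately show ?thesis
    unfolding b_def[symmetric] by simp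
qed

end

section \<open>Accumulated decrease and the constants of the algorithm\<close>

text \<open>Jensen's inequality for the cube, applied to the \<open>j\<close> given lengths padded
  with n - j zeros.\<close>

lemma prefix_sum_cube_le:
  fixes r :: "nat \<Rightarrow> real"
  assumes "\<And>j. 0 \<le> r j" "j \<le> n" "1 \<le> n"
  shows "real n * ((\<Sum>i<j. r i) / n) ^ 3 \<le> (\<Sum>i<j. r i ^ 3)"
proof -
  define w where "w = (\<Sum>i<j. r i) / n"
  have "0 \<le> w"
    using assms by (simp add: w_def sum_nonneg)
  have nw: "real n * w = (\<Sum>i<j. r i)"
    using assms by (simp add: w_def)
  \<comment> \<open>On the nonnegative axis the cube lies above its tangent at the mean
    \<open>w\<close>.\<close>
  have tangent: "3 * w\<^sup>2 * r i - 2 * w ^ 3 \<le> r i ^ 3" for i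
  proof -
    have "0 \<le> (r i - w)\<^sup>2 * (r i + 2 * w)"
      using \<open>0 \<le> w\<close> assms by simp
    then show ?thesis
      by (simp add: algebra_simps power2_eq_square power3_eq_cube)
  qed
  have "real n * w ^ 3 = 3 * w\<^sup>2 * (real n * w) - 2 * real n * w ^ 3"
    by (simp add: power2_eq_square power3_eq_cube)
  also have "\<dots> \<le> 3 * w\<^sup>2 * (real n * w) - 2 * real j * w ^ 3"
    using assms \<open>0 \<le> w\<close> by (simp add: mult_right_mono)
  also have "\<dots> = (\<Sum>i<j. 3 * w\<^sup>2 * r i - 2 * w ^ 3)"
    by (simp add: nw sum_subtractf sum_distrib_left)
  also have "\<dots> \<le> (\<Sum>i<j. r i ^ 3)"
    by (rule sum_mono) (rule tangent)
  finally show ?thesis by (simp add: w_def)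
qed

text \<open>A drift \<open>w\<close> of at least \<open>e\<close> suffices alone. Otherwise the
  hypothesis forces r \<ge> 0.8 e, and 0.8^3 = 0.512 exceeds 1/2.\<close>

lemma step_or_drift_large:
  fixes r w e :: real
  assumes "0 \<le> r" "0 \<le> w" "0 < e"
    and "e\<^sup>2 < (3/4 + 1/26) * r\<^sup>2 + (e / 40 + w / 13) * r"
  shows "e ^ 3 / 2 \<le> r ^ 3 + w ^ 3"
proof (cases "e \<le> w")
  case True
  then have "e ^ 3 \<le> w ^ 3" using assms by (intro power_mono) auto
  moreover have "0 \<le> r ^ 3" "0 \<le> e ^ 3" using assms by auto
  ultimately show ?thesis by linarith
next
  case False
  have "8/10 * e \<le> r"
  proof (rule ccontr)
    assume "\<not> 8/10 * e \<le> r"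
    then have r: "r \<le> 8/10 * e" by simp
    have "(3/4 + 1/26) * r\<^sup>2 \<le> (3/4 + 1/26) * (8/10 * e)\<^sup>2"
      using r assms by (intro mult_left_mono power_mono) auto
    moreover have "(e / 40 + w / 13) * r \<le> (e / 40 + e / 13) * (8/10 * e)"
      using False r assms by (intro mult_mono) auto
    ultimately have "e\<^sup>2 < (3/4 + 1/26) * (8/10 * e)\<^sup>2 + (e / 40 + e / 13) * (8/10 * e)"
      using less_le_trans[OF assms(4)] add_mono by blast
    then have "e\<^sup>2 < 3/4 * e\<^sup>2"
      by (simp add: power2_eq_square algebra_simps)
    then show False using assms by simp
  qed
  then have "(8/10 * e) ^ 3 \<le> r ^ 3"
    using assms by (intro power_mono) auto
  moreover have "0 \<le> w ^ 3" "0 \<le> e ^ 3" using assms by auto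
  ultimately show ?thesis by (simp add: power_mult_distrib power3_eq_cube)
qed

text \<open>Young's inequality with exponents 3/2 and 3.\<close>

lemma square_mult_le_cubes:
  fixes a b :: real
  assumes "0 \<le> a" "0 \<le> b"
  shows "3 * (b * a\<^sup>2) \<le> 2 * a ^ 3 + b ^ 3"
proof -
  have "0 \<le> (a - b)\<^sup>2 * (2 * a + b)"
    using assms by simp
  then show ?thesis
    by (simp add: algebra_simps power2_eq_square power3_eq_cube)
qed

text \<open>Up to the factor \<open>\<sigma>\<close>, the summand is the guaranteed decrease of a step of length \<open>r j\<close>, with
  \<open>e = sqrt (\<epsilon> / \<sigma>)\<close> and \<open>L \<le> \<sigma> / (13 n)\<close>; the hypothesis says that the step missed the
  stationarity test.\<close>

lemma accumulated_decrease:
  fixes r :: "nat \<Rightarrow> real" and e :: real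
  assumes r: "\<And>j. 0 \<le> r j" and "0 < e" "N \<le> n" "1 \<le> n"
    and large: "\<And>j. j < N \<Longrightarrow>
      e\<^sup>2 < (3/4 + 1/26) * r j ^ 2 + (e / 40 + (\<Sum>i<j. r i) / n / 13) * r j"
  shows "real N * e ^ 3 / 384 \<le>
    (\<Sum>j<N. 2/13 * r j ^ 3 - e / 80 * r j ^ 2 - (\<Sum>i<j. r i) / n / 26 * r j ^ 2)"
proof -
  define w where "w j = (\<Sum>i<j. r i) / n" for j
  define R where "R = (\<Sum>j<N. r j ^ 3)"
  have w: "0 \<le> w j" for j
    using r by (simp add: w_def sum_nonneg)
  have "0 \<le> R"
    using r by (simp add: R_def sum_nonneg)
  have wR: "real n * w j ^ 3 \<le> R" if "j < N" for j
  proof -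
    have "real n * w j ^ 3 \<le> (\<Sum>i<j. r i ^ 3)"
      unfolding w_def using assms that by (intro prefix_sum_cube_le) auto
    also have "\<dots> \<le> R"
      unfolding R_def using r that by (intro sum_mono2) auto
    finally show ?thesis .
  qed
  \<comment> \<open>Each drift cube is at most R / n and there are N \<le> n of them, so the drift
    costs no more than \<open>R\<close> in total. Here the cap of n steps per call enters.\<close>
  have "real n * (\<Sum>j<N. w j ^ 3) \<le> real N * R"
    using sum_mono[of "{..<N}" "\<lambda>j. real n * w j ^ 3" "\<lambda>_. R"] wR by (simp add: sum_distrib_left)
  also have "\<dots> \<le> real n * R"
    using \<open>0 \<le> R\<close> assms by (intro mult_right_mono) auto
  finally have sum_w: "(\<Sum>j<N. w j ^ 3) \<le> R"
    using assms by simp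
  have "real N * (e ^ 3 / 2) \<le> (\<Sum>j<N. r j ^ 3 + w j ^ 3)"
    using sum_mono[of "{..<N}" "\<lambda>_. e ^ 3 / 2" "\<lambda>j. r j ^ 3 + w j ^ 3"]
      step_or_drift_large[OF r w \<open>0 < e\<close>] large by (simp add: w_def)
  then have R_large: "real N * e ^ 3 \<le> 4 * R"
    using sum_w by (simp add: sum.distrib R_def)
  \<comment> \<open>Young's inequality trades each negative term for cubes of the step length,
    \<open>e\<close> and the drift.\<close>
  have "2/13 * r j ^ 3 - (2 * r j ^ 3 + e ^ 3) / 240 - (2 * r j ^ 3 + w j ^ 3) / 78
      \<le> 2/13 * r j ^ 3 - e / 80 * r j ^ 2 - w j / 26 * r j ^ 2" for j
  proof -
    have "e / 80 * r j ^ 2 \<le> (2 * r j ^ 3 + e ^ 3) / 240"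
      using divide_right_mono[OF square_mult_le_cubes[OF r[of j] less_imp_le[OF \<open>0 < e\<close>]], of 240]
      by simp
    moreover have "w j / 26 * r j ^ 2 \<le> (2 * r j ^ 3 + w j ^ 3) / 78"
      using divide_right_mono[OF square_mult_le_cubes[OF r[of j] w[of j]], of 78] by simp
    ultimately show ?thesis
      by (intro diff_mono order_refl)
  qed
  then have "(\<Sum>j<N. 2/13 * r j ^ 3 - (2 * r j ^ 3 + e ^ 3) / 240 - (2 * r j ^ 3 + w j ^ 3) / 78)
      \<le> (\<Sum>j<N. 2/13 * r j ^ 3 - e / 80 * r j ^ 2 - w j / 26 * r j ^ 2)"
    by (intro sum_mono) simp
  moreover have "(\<Sum>j<N. 2/13 * r j ^ 3 - (2 * r j ^ 3 + e ^ 3) / 240 - (2 * r j ^ 3 + w j ^ 3) / 78)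
      = 2/13 * R - (2 * R + real N * e ^ 3) / 240 - (2 * R + (\<Sum>j<N. w j ^ 3)) / 78"
    by (simp add: sum_subtractf sum.distrib sum_distrib_left[symmetric] sum_divide_distrib[symmetric] R_def)
  moreover have "real N * e ^ 3 / 384
      \<le> 2/13 * R - (2 * R + real N * e ^ 3) / 240 - (2 * R + (\<Sum>j<N. w j ^ 3)) / 78"
  proof -
    \<comment> \<open>With z \<le> y the coefficient of y is at least 2/13 - 1/120 - 1/26 > 1/10,
      while x \<le> 4 y requires only 4 (1/384 + 1/240) < 1/30.\<close>
    have "x / 384 \<le> 2/13 * y - (2 * y + x) / 240 - (2 * y + z) / 78"
      if "z \<le> y" "x \<le> 4 * y" "0 \<le> y" for x y z :: real
      using that by (simp add: field_simps)
    from this[OF sum_w R_large \<open>0 \<le> R\<close>] show ?thesis .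
  qed
  ultimately show ?thesis
    unfolding w_def by linarith
qed

section \<open>Parameters of the algorithm\<close>

lemma powr_three_halves: "0 \<le> (x::real) \<Longrightarrow> x powr (3/2) = sqrt x ^ 3"
  by (cases "x = 0") (simp_all add: powr_half_sqrt[symmetric] powr_power)

text \<open>The factor 16 (2/3)^(1/3) is about 13.98. The lower value 13 absorbs the Lipschitz
  terms; the upper value 16 has an exact square root for the final count.\<close>

lemma cnm_sigma_bounds:
  assumes "0 < T" "1 \<le> m"
  shows "0 < cnm_sigma m T" "13 * real m * T \<le> cnm_sigma m T" "cnm_sigma m T \<le> 16 * real m * T"
proof -
  define c where "c = (2/3 :: real) powr (1/3)"
  have "c ^ 3 = 2/3" "0 \<le> c"
    by (simp_all add: c_def powr_power)
  then have "13/16 \<le> c" "c \<le> 1"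
    using power_le_imp_le_base[of "13/16" 2 c] power_le_imp_le_base[of c 2 1]
    by (simp_all add: eval_nat_numeral)
  moreover have "cnm_sigma m T = (16 * c) * (real m * T)"
    by (simp add: cnm_sigma_def c_def)
  moreover have "0 < real m * T"
    using assms by simp
  ultimately show "0 < cnm_sigma m T" "13 * real m * T \<le> cnm_sigma m T"
    "cnm_sigma m T \<le> 16 * real m * T"
    using mult_right_mono[of 13 "16 * c" "real m * T"] mult_right_mono[of "16 * c" 16 "real m * T"]
    by (auto simp: mult.assoc)
qed

lemma cnm_h_pos: "0 < T \<Longrightarrow> 0 < \<epsilon> \<Longrightarrow> 1 \<le> n \<Longrightarrow> 1 \<le> m \<Longrightarrow> 0 < cnm_h n m \<epsilon> T"
  using cnm_sigma_bounds(1)[of T m] by (simp add: cnm_h_def)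

text \<open>Cubing removes the cube root in \<open>cnm_h\<close>: the left side becomes (\<sigma>
  \<epsilon>)^(3/2) (L / T)^3 / 65536, and 65536 exceeds 40^3 = 64000.\<close>

lemma finite_difference_error_le:
  assumes "0 < T" "0 < \<epsilon>" "1 \<le> n" "0 \<le> L" "L \<le> T"
  defines "\<sigma> \<equiv> cnm_sigma n T"
  shows "sqrt (real n) * (L * cnm_h n n \<epsilon> T / 2) \<le> \<sigma> * (sqrt (\<epsilon> / \<sigma>) / 40)"
proof -
  define p q s where "p = sqrt \<sigma>" and "q = sqrt \<epsilon>" and "s = sqrt (real n)"
  have \<sigma>: "0 < \<sigma>"
    unfolding \<sigma>_def by (rule cnm_sigma_bounds) (use assms in auto)
  have pos: "0 < p" "0 < q" "0 < s"
    using \<sigma> assms by (auto simp: p_def q_def s_def)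
  have h: "0 < cnm_h n n \<epsilon> T"
    using assms by (intro cnm_h_pos) auto
  have h3: "cnm_h n n \<epsilon> T ^ 3 = 3 * p ^ 3 * q ^ 3 / (2 ^ 7 * 192 * s ^ 3 * T ^ 3)"
    using \<sigma> assms unfolding cnm_h_def \<sigma>_def[symmetric] p_def q_def s_def
    by (simp add: powr_three_halves powr_power)
  have "(s * (L * cnm_h n n \<epsilon> T / 2)) ^ 3 = s ^ 3 * L ^ 3 * cnm_h n n \<epsilon> T ^ 3 / 8"
    by (simp add: power_mult_distrib power_divide)
  also have "\<dots> = (p * q) ^ 3 / 65536 * (L / T) ^ 3"
    using pos assms by (simp add: h3 field_simps)
  also have "\<dots> \<le> (p * q) ^ 3 / 65536 * 1"
    using pos assms by (intro mult_left_mono power_le_one) auto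
  also have "\<dots> \<le> (p * q / 40) ^ 3"
    using pos by (simp add: power_divide)
  finally have "s * (L * cnm_h n n \<epsilon> T / 2) \<le> p * q / 40"
    using pos h \<open>0 \<le> L\<close> by (subst (asm) power_mono_iff) auto
  moreover have "\<sigma> * sqrt (\<epsilon> / \<sigma>) = p * q"
    using \<sigma> assms by (simp add: p_def q_def real_sqrt_divide field_simps)
  ultimately show ?thesis
    by (simp add: s_def)
qed

lemma decrease_constant_eq:
  assumes "0 < \<sigma>" "0 < \<epsilon>"
  shows "\<epsilon> powr (3/2) / (384 * \<sigma> powr (1/2)) = \<sigma> * (sqrt (\<epsilon> / \<sigma>) ^ 3 / 384)"
proof -
  define p where "p = sqrt \<sigma>"
  have "\<sigma> = p * p" "0 < p"
    using assms by (simp_all add: p_def)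
  then show ?thesis
    using assms
    by (simp add: powr_three_halves powr_half_sqrt real_sqrt_divide power_divide power3_eq_cube field_simps)
qed

section \<open>CubicSteps\<close>

text \<open>Real-valued form of \<open>composite\<close>, meaningful on the effective domain only:
  \<open>real_of_ereal\<close> sends infinity to 0.\<close>

definition objective :: "(fseq \<Rightarrow> real) \<Rightarrow> (fseq \<Rightarrow> ereal) \<Rightarrow> fseq \<Rightarrow> real"
  where "objective f \<psi> x = f x + real_of_ereal (\<psi> x)"

lemma eff_dom_Rn: "x \<in> eff_dom n \<psi> \<Longrightarrow> x \<in> Rn n"
  by (simp add: eff_dom_def)

lemma eff_dom_finite:
  assumes "proper_closed_convex n \<psi>" "x \<in> eff_dom n \<psi>"
  shows "\<psi> x = ereal (real_of_ereal (\<psi> x))"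
proof -
  have "\<bar>\<psi> x\<bar> \<noteq> \<infinity>"
    using assms by (auto simp: proper_closed_convex_def eff_dom_def)
  then show ?thesis by (simp add: ereal_real)
qed

lemma composite_eq:
  assumes "proper_closed_convex n \<psi>" "x \<in> eff_dom n \<psi>"
  shows "composite f \<psi> x = ereal (objective f \<psi> x)"
proof -
  obtain r where "\<psi> x = ereal r"
    using eff_dom_finite[OF assms] by blast
  then show ?thesis by (simp add: composite_def objective_def)
qed

lemma sufficient_decrease_iff:
  assumes "proper_closed_convex n \<psi>" "x \<in> eff_dom n \<psi>" "y \<in> eff_dom n \<psi>"
  shows "sufficient_decrease f \<psi> \<sigma> \<epsilon> x t y \<longleftrightarrow>
    \<epsilon> powr (3/2) / (384 * \<sigma> powr (1/2)) * (real t + 1) \<le> objective f \<psi> x - objective f \<psi> y"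
  using assms by (simp add: sufficient_decrease_def composite_eq)

lemma inexact_step_dom: "inexact_step n f \<psi> B \<sigma> x y p \<Longrightarrow> y \<in> eff_dom n \<psi>"
  by (simp add: inexact_step_def)

text \<open>The hypothesis on the decrease at counter \<open>t\<close> is renewed at
  \<open>Suc t\<close> by the test that was passed; at \<open>t = m\<close> it is the guarantee
  attached to \<open>Success\<close>.\<close>

lemma cubic_loop_progress:
  assumes "proper_closed_convex n \<psi>" "x0 \<in> eff_dom n \<psi>"
    and "cubic_loop n f \<psi> B \<sigma> m \<epsilon> x0 t x y \<alpha> c" "t \<le> m" "x \<in> eff_dom n \<psi>"
    and "\<epsilon> powr (3/2) / (384 * \<sigma> powr (1/2)) * real t \<le> objective f \<psi> x0 - objective f \<psi> x"
  shows "y \<in> eff_dom n \<psi> \<and> c \<le> m - t \<and> (\<alpha> = Solution \<longrightarrow> eps_stationary n f \<psi> \<epsilon> y) \<and>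
    (\<alpha> = Success \<longrightarrow>
      \<epsilon> powr (3/2) / (384 * \<sigma> powr (1/2)) * real m \<le> objective f \<psi> x0 - objective f \<psi> y)"
  using assms(3-)
proof (induction rule: cubic_loop.induct)
  case (solution t xt y p)
  then show ?case
    by (auto simp: inexact_step_def eps_stationary_def)
next
  case (continue t xt y p z \<alpha> c)
  have y: "y \<in> eff_dom n \<psi>"
    using continue by (simp add: inexact_step_def)
  have "\<epsilon> powr (3/2) / (384 * \<sigma> powr (1/2)) * real (Suc t) \<le> objective f \<psi> x0 - objective f \<psi> y"
    using continue(4) sufficient_decrease_iff[OF assms(1,2) y] by (simp add: add.commute)
  with continue y show ?case
    by auto
qed (auto simp: inexact_step_def)

context lipschitz_hessian
begin

text \<open>For the decrease, Taylor's bound and the model differ only in the quadratic term (error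
  \<beta>) and the cubic coefficient (\<open>L\<close> against \<sigma>). In the gradient bound, 3/4
  adds 1/4 from the inexactness test and 1/2 from the gradient of the cubic term.\<close>

lemma inexact_step_bounds:
  assumes "proper_closed_convex n \<psi>" "x \<in> eff_dom n \<psi>" "\<And>i j. B i j = B j i"
    and B: "\<And>v. v \<in> Rn n \<Longrightarrow> norm (mat_vec n B v - Hess x v) \<le> \<beta> * norm v"
    and step: "inexact_step n f \<psi> B \<sigma> x y p" and "0 \<le> \<sigma>"
  shows "(\<sigma> - L) / 6 * norm (y - x) ^ 3 - \<beta> / 2 * norm (y - x) ^ 2
      \<le> objective f \<psi> x - objective f \<psi> y"
    and "norm (grad y + p) \<le> (3/4 * \<sigma> + L / 2) * norm (y - x) ^ 2 + \<beta> * norm (y - x)"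
proof -
  define s where "s = y - x"
  have y: "y \<in> eff_dom n \<psi>"
    using step by (rule inexact_step_dom)
  have Rn: "x \<in> Rn n" "y \<in> Rn n" "s \<in> Rn n" and y_eq: "y = x + s"
    using assms(2) y by (auto simp: s_def eff_dom_Rn)
  note Bs = B[OF \<open>s \<in> Rn n\<close>]
  have "\<bar>inner (mat_vec n B s - Hess x s) s\<bar> \<le> norm (mat_vec n B s - Hess x s) * norm s"
    by (rule Cauchy_Schwarz_ineq2)
  also have "\<dots> \<le> (\<beta> * norm s) * norm s"
    by (rule mult_right_mono[OF Bs]) simp
  finally have quad: "inner (Hess x s) s - inner (mat_vec n B s) s \<le> \<beta> * norm s ^ 2"
    by (simp add: inner_diff_left power2_eq_square)
  have "f y \<le> f x + inner (grad x) s + 1/2 * inner (Hess x s) s + L / 6 * norm s ^ 3"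
    unfolding y_eq by (rule taylor) (use Rn in auto)
  moreover have "ereal (cubic_model n f B \<sigma> x y) + \<psi> y \<le> composite f \<psi> x"
    using step by (simp add: inexact_step_def)
  then have "cubic_model n f B \<sigma> x y + real_of_ereal (\<psi> y) \<le> objective f \<psi> x"
    unfolding composite_eq[OF assms(1,2)]
    by (subst (asm) eff_dom_finite[OF assms(1) y]) simp
  then have "f x + inner (grad x) s + 1/2 * inner (mat_vec n B s) s + \<sigma> / 6 * norm s ^ 3
      + real_of_ereal (\<psi> y) \<le> objective f \<psi> x"
    by (simp add: cubic_model_def s_def)
  ultimately show "(\<sigma> - L) / 6 * norm (y - x) ^ 3 - \<beta> / 2 * norm (y - x) ^ 2
      \<le> objective f \<psi> x - objective f \<psi> y"
    using quad unfolding s_def[symmetric] objective_def[of f \<psi> y]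
    by (simp add: left_diff_distrib diff_divide_distrib)
  define G where "G = gradient n (cubic_model n f B \<sigma> x) y"
  have G: "G = grad x + mat_vec n B s + (\<sigma> / 2 * norm s) *\<^sub>R s"
    unfolding G_def s_def
    by (rule gradient_cubic_model) (use Rn has_gradient_grad assms(3) in auto)
  have "norm (a + b - c - d) \<le> norm a + norm b + norm c + norm d" for a b c d :: fseq
    by norm
  \<comment> \<open>By the formula for \<open>G\<close>, these four vectors with signs +, +, -, -
    sum to \<open>grad y + p\<close>.\<close>
  from this[of "G + p" "grad (x + s) - grad x - Hess x s" "mat_vec n B s - Hess x s"
      "(\<sigma> / 2 * norm s) *\<^sub>R s"]
  have "norm (grad y + p) \<le> norm (G + p) + norm (grad (x + s) - grad x - Hess x s)
      + norm (mat_vec n B s - Hess x s) + norm ((\<sigma> / 2 * norm s) *\<^sub>R s)"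
    by (simp add: G y_eq add.commute[of p])
  moreover have "norm (G + p) \<le> \<sigma> / 4 * norm s ^ 2"
    using step by (simp add: inexact_step_def G_def s_def)
  moreover have "norm (grad (x + s) - grad x - Hess x s) \<le> L / 2 * norm s ^ 2"
    by (rule grad_taylor) (use Rn in auto)
  moreover have "norm ((\<sigma> / 2 * norm s) *\<^sub>R s) = \<sigma> / 2 * norm s ^ 2"
    using \<open>0 \<le> \<sigma>\<close> by (simp add: power2_eq_square)
  ultimately show "norm (grad y + p) \<le> (3/4 * \<sigma> + L / 2) * norm (y - x) ^ 2 + \<beta> * norm (y - x)"
    using Bs unfolding s_def[symmetric] by (simp add: distrib_right)
qed

text \<open>The lengths \<open>r j\<close> of the steps made so far bound both the drift from \<open>x0\<close>, where B
  approximates the Hessian, and the decrease achieved.\<close>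

definition steps_invariant :: "(fseq \<Rightarrow> ereal) \<Rightarrow> real \<Rightarrow> real \<Rightarrow> fseq \<Rightarrow> nat \<Rightarrow> fseq \<Rightarrow> (nat \<Rightarrow> real) \<Rightarrow> bool"
  where "steps_invariant \<psi> \<sigma> e x0 t x r \<longleftrightarrow>
    x \<in> eff_dom n \<psi> \<and> (\<forall>j. 0 \<le> r j) \<and> norm (x - x0) \<le> (\<Sum>i<t. r i) \<and>
    (\<forall>j<t. e\<^sup>2 < (3/4 + 1/26) * r j ^ 2 + (e / 40 + (\<Sum>i<j. r i) / n / 13) * r j) \<and>
    \<sigma> * (\<Sum>j<t. 2/13 * r j ^ 3 - e / 80 * r j ^ 2 - (\<Sum>i<j. r i) / n / 26 * r j ^ 2)
      \<le> objective f \<psi> x0 - objective f \<psi> x"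

text \<open>The drift D adds at most L D to the matrix error. Since 13 n L \<le> \<sigma>, this is
  at most \<sigma> / 13 times D / n; all errors become multiples of \<sigma>, which then
  cancels.\<close>

lemma steps_invariant_step:
  assumes "proper_closed_convex n \<psi>" "x0 \<in> eff_dom n \<psi>" "1 \<le> n" "0 \<le> L"
    and sym: "\<And>i j. B i j = B j i"
    and B: "\<And>v. v \<in> Rn n \<Longrightarrow> norm (mat_vec n B v - Hess x0 v) \<le> \<sigma> * (e / 40) * norm v"
    and "0 < \<sigma>" "0 < e" "13 * real n * L \<le> \<sigma>"
    and inv: "steps_invariant \<psi> \<sigma> e x0 t x r"
    and step: "inexact_step n f \<psi> B \<sigma> x y p" and large: "\<sigma> * e\<^sup>2 < norm (grad y + p)"
  shows "steps_invariant \<psi> \<sigma> e x0 (Suc t) y (r(t := norm (y - x)))"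
proof -
  define R where "R = norm (y - x)"
  define D where "D = (\<Sum>i<t. r i)"
  define r' where "r' = r(t := R)"
  have dom: "x \<in> eff_dom n \<psi>" "y \<in> eff_dom n \<psi>" and r: "0 \<le> r j" for j
    using inv inexact_step_dom[OF step] by (auto simp: steps_invariant_def)
  have "0 \<le> R" "0 \<le> D"
    using r by (auto simp: R_def D_def sum_nonneg)
  have prefix: "(\<Sum>i<j. r' i) = (\<Sum>i<j. r i)" if "j \<le> t" for j
    unfolding r'_def using that by (intro sum.cong) auto
  have drift: "norm (x - x0) \<le> D"
    using inv by (simp add: steps_invariant_def D_def)
  define \<beta> where "\<beta> = \<sigma> * (e / 40) + L * D"
  have "norm (mat_vec n B v - Hess x v) \<le> \<beta> * norm v" if "v \<in> Rn n" for v
  proof -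
    have "norm (Hess x v - Hess x0 v) \<le> L * norm (x - x0) * norm v"
      using assms(2) dom by (intro Hess_lipschitz) (auto simp: eff_dom_Rn)
    also have "\<dots> \<le> L * D * norm v"
      using drift \<open>0 \<le> L\<close> by (intro mult_right_mono mult_left_mono) auto
    finally show ?thesis
      using B[OF that] norm_triangle_ineq4[of "mat_vec n B v - Hess x0 v" "Hess x v - Hess x0 v"]
      by (simp add: \<beta>_def distrib_right)
  qed
  note bounds = inexact_step_bounds[OF assms(1) dom(1) sym this step less_imp_le[OF \<open>0 < \<sigma>\<close>],
      folded R_def]
  have L: "L * real n \<le> \<sigma> / 13"
    using assms(9) by (simp add: mult_ac)
  moreover have "L \<le> L * real n"
    using \<open>0 \<le> L\<close> \<open>1 \<le> n\<close> by (simp add: mult_le_cancel_left1)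
  \<comment> \<open>Source of two constants: L / 2 contributes 1/26 to the gradient bound, and (1 -
    1/13) / 6 = 2/13 remains in the decrease.\<close>
  ultimately have L': "L \<le> \<sigma> / 13"
    by linarith
  have "L * D = L * real n * (D / n)"
    using \<open>1 \<le> n\<close> by simp
  also have "\<dots> \<le> \<sigma> / 13 * (D / n)"
    using L \<open>0 \<le> D\<close> by (intro mult_right_mono) auto
  finally have \<beta>: "\<beta> \<le> \<sigma> * (e / 40 + D / n / 13)"
    by (simp add: \<beta>_def distrib_left)
  have "\<sigma> * e\<^sup>2 < (3/4 * \<sigma> + L / 2) * R ^ 2 + \<beta> * R"
    using large bounds(2) by linarith
  also have "\<dots> \<le> (\<sigma> * (3/4 + 1/26)) * R ^ 2 + \<sigma> * (e / 40 + D / n / 13) * R"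
    using L' \<beta> \<open>0 \<le> R\<close> by (intro add_mono mult_right_mono) auto
  also have "\<dots> = \<sigma> * ((3/4 + 1/26) * R ^ 2 + (e / 40 + D / n / 13) * R)"
    by (simp add: algebra_simps)
  finally have large_R: "e\<^sup>2 < (3/4 + 1/26) * R ^ 2 + (e / 40 + D / n / 13) * R"
    using \<open>0 < \<sigma>\<close> by (simp only: mult_less_cancel_left_pos)
  have "\<sigma> * (2/13 * R ^ 3 - e / 80 * R ^ 2 - D / n / 26 * R ^ 2)
      = \<sigma> * (2/13) * R ^ 3 - \<sigma> * (e / 40 + D / n / 13) / 2 * R ^ 2"
    by (simp add: algebra_simps)
  also have "\<dots> \<le> (\<sigma> - L) / 6 * R ^ 3 - \<beta> / 2 * R ^ 2"
    using L' \<beta> \<open>0 \<le> R\<close> by (intro diff_mono mult_right_mono divide_right_mono) auto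
  also have "\<dots> \<le> objective f \<psi> x - objective f \<psi> y"
    by (rule bounds(1))
  finally have decr: "\<sigma> * (2/13 * R ^ 3 - e / 80 * R ^ 2 - D / n / 26 * R ^ 2)
      \<le> objective f \<psi> x - objective f \<psi> y" .
  have "steps_invariant \<psi> \<sigma> e x0 (Suc t) y r'"
    unfolding steps_invariant_def
  proof (intro conjI allI impI)
    show "0 \<le> r' j" for j
      using r \<open>0 \<le> R\<close> by (simp add: r'_def)
    have "norm (y - x0) \<le> R + norm (x - x0)"
      unfolding R_def by norm
    then show "norm (y - x0) \<le> (\<Sum>i<Suc t. r' i)"
      using drift by (simp add: prefix D_def) (simp add: r'_def)
    show "e\<^sup>2 < (3/4 + 1/26) * r' j ^ 2 + (e / 40 + (\<Sum>i<j. r' i) / n / 13) * r' j" if "j < Suc t" for j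
    proof (cases "j = t")
      case True
      then show ?thesis
        using large_R by (simp only: prefix order_refl D_def) (simp only: r'_def fun_upd_same)
    next
      case False
      then have "j < t" using that by simp
      moreover from this have "r' j = r j" by (simp add: r'_def)
      ultimately show ?thesis
        using inv by (simp only: prefix less_imp_le steps_invariant_def)
    qed
    have "(\<Sum>j<t. 2/13 * r' j ^ 3 - e / 80 * r' j ^ 2 - (\<Sum>i<j. r' i) / n / 26 * r' j ^ 2)
        = (\<Sum>j<t. 2/13 * r j ^ 3 - e / 80 * r j ^ 2 - (\<Sum>i<j. r i) / n / 26 * r j ^ 2)"
      by (rule sum.cong) (auto simp: prefix, auto simp: r'_def)
    then have "\<sigma> * (\<Sum>j<Suc t. 2/13 * r' j ^ 3 - e / 80 * r' j ^ 2 - (\<Sum>i<j. r' i) / n / 26 * r' j ^ 2)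
        = \<sigma> * (\<Sum>j<t. 2/13 * r j ^ 3 - e / 80 * r j ^ 2 - (\<Sum>i<j. r i) / n / 26 * r j ^ 2)
          + \<sigma> * (2/13 * R ^ 3 - e / 80 * R ^ 2 - D / n / 26 * R ^ 2)"
      unfolding sum.lessThan_Suc D_def prefix[OF order_refl] distrib_left[symmetric]
      by (simp add: r'_def)
    then show "\<sigma> * (\<Sum>j<Suc t. 2/13 * r' j ^ 3 - e / 80 * r' j ^ 2 - (\<Sum>i<j. r' i) / n / 26 * r' j ^ 2)
        \<le> objective f \<psi> x0 - objective f \<psi> y"
      using inv decr by (simp add: steps_invariant_def)
  qed (rule dom)
  then show ?thesis
    by (simp add: r'_def R_def)
qed

text \<open>Each step that misses the stationarity test extends \<open>steps_invariant\<close>;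
  \<open>accumulated_decrease\<close> then contradicts the failed decrease test of a halt.\<close>

lemma cubic_loop_no_halt:
  assumes "proper_closed_convex n \<psi>" "x0 \<in> eff_dom n \<psi>" "1 \<le> n" "0 \<le> L"
    and sym: "\<And>i j. B i j = B j i"
    and B: "\<And>v. v \<in> Rn n \<Longrightarrow> norm (mat_vec n B v - Hess x0 v) \<le> \<sigma> * (sqrt (\<epsilon> / \<sigma>) / 40) * norm v"
    and "0 < \<sigma>" "0 < \<epsilon>" "13 * real n * L \<le> \<sigma>"
    and "cubic_loop n f \<psi> B \<sigma> n \<epsilon> x0 t x y \<alpha> c" "t \<le> n"
    and "steps_invariant \<psi> \<sigma> (sqrt (\<epsilon> / \<sigma>)) x0 t x r"
  shows "\<alpha> \<noteq> Halt"
proof -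
  define e where "e = sqrt (\<epsilon> / \<sigma>)"
  have e: "0 < e" "\<epsilon> = \<sigma> * e\<^sup>2"
    using assms by (simp_all add: e_def)
  note step = steps_invariant_step[OF assms(1-4) sym B \<open>0 < \<sigma>\<close> _ assms(9), folded e_def, OF _ e(1)]
  show ?thesis
    using assms(10-12)[folded e_def]
  proof (induction arbitrary: r rule: cubic_loop.induct)
    case (continue t xt y p z \<alpha> c)
    have "steps_invariant \<psi> \<sigma> e x0 (Suc t) y (r(t := norm (y - xt)))"
      by (rule step) (use continue e in auto)
    then show ?case
      using continue by auto
  next
    case (halt t xt y p)
    \<comment> \<open>The rejected step missed the stationarity test too, so it is recorded as well.
      Since t \<noteq> n, the number \<open>Suc t\<close> of steps is still at most n.\<close>
    define r' where "r' = r(t := norm (y - xt))"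
    have inv: "steps_invariant \<psi> \<sigma> e x0 (Suc t) y r'"
      unfolding r'_def by (rule step) (use halt e in auto)
    have "real (Suc t) * e ^ 3 / 384 \<le>
        (\<Sum>j<Suc t. 2/13 * r' j ^ 3 - e / 80 * r' j ^ 2 - (\<Sum>i<j. r' i) / n / 26 * r' j ^ 2)"
      by (rule accumulated_decrease)
        (use inv e assms(3) halt in \<open>auto simp: steps_invariant_def simp del: sum.lessThan_Suc\<close>)
    then have "\<sigma> * (real (Suc t) * e ^ 3 / 384) \<le>
        \<sigma> * (\<Sum>j<Suc t. 2/13 * r' j ^ 3 - e / 80 * r' j ^ 2 - (\<Sum>i<j. r' i) / n / 26 * r' j ^ 2)"
      using \<open>0 < \<sigma>\<close> by (intro mult_left_mono) auto
    also have "\<dots> \<le> objective f \<psi> x0 - objective f \<psi> y"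
      using inv unfolding steps_invariant_def by blast
    finally have "\<sigma> * (e ^ 3 / 384) * (real t + 1) \<le> objective f \<psi> x0 - objective f \<psi> y"
      by (simp add: mult_ac add.commute)
    moreover have "y \<in> eff_dom n \<psi>"
      using inv by (simp add: steps_invariant_def)
    ultimately have "sufficient_decrease f \<psi> \<sigma> \<epsilon> x0 t y"
      unfolding e_def decrease_constant_eq[OF assms(7,8), symmetric]
      by (simp only: sufficient_decrease_iff[OF assms(1,2)])
    with halt show ?case by blast
  qed simp_all
qed

text \<open>T \<ge> L is used twice: it makes \<sigma> at least 13 n L, and it keeps the finite
  difference error below its share sqrt (\<sigma> \<epsilon>) / 40.\<close>

lemma cubic_steps_no_halt:
  assumes "proper_closed_convex n \<psi>" "x \<in> eff_dom n \<psi>" "1 \<le> n" "0 \<le> L" "L \<le> T" "0 < T" "0 < \<epsilon>"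
    and "cubic_steps n f \<psi> x (cnm_B n n f \<epsilon> x T) (cnm_sigma n T) n \<epsilon> y \<alpha> c"
  shows "\<alpha> \<noteq> Halt"
proof (rule cubic_loop_no_halt[OF assms(1-4)])
  show "cnm_B n n f \<epsilon> x T i j = cnm_B n n f \<epsilon> x T j i" for i j
    by (simp add: cnm_B_def)
  show "0 < cnm_sigma n T"
    using assms by (intro cnm_sigma_bounds) auto
  have "13 * real n * L \<le> 13 * real n * T"
    using assms by (intro mult_left_mono) auto
  then show "13 * real n * L \<le> cnm_sigma n T"
    using cnm_sigma_bounds(2)[OF assms(6,3)] by linarith
  show "norm (mat_vec n (cnm_B n n f \<epsilon> x T) v - Hess x v)
      \<le> cnm_sigma n T * (sqrt (\<epsilon> / cnm_sigma n T) / 40) * norm v" if "v \<in> Rn n" for v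
  proof -
    have "norm (mat_vec n (cnm_B n n f \<epsilon> x T) v - Hess x v)
        \<le> sqrt (real n) * (L * cnm_h n n \<epsilon> T / 2) * norm v"
      using assms that by (intro norm_cnm_B_diff cnm_h_pos eff_dom_Rn[OF assms(2)])
    also have "\<dots> \<le> cnm_sigma n T * (sqrt (\<epsilon> / cnm_sigma n T) / 40) * norm v"
      using assms by (intro mult_right_mono finite_difference_error_le) auto
    finally show ?thesis .
  qed
  show "cubic_loop n f \<psi> (cnm_B n n f \<epsilon> x T) (cnm_sigma n T) n \<epsilon> x 0 x y \<alpha> c"
    using assms by (simp add: cubic_steps_def)
  show "steps_invariant \<psi> (cnm_sigma n T) (sqrt (\<epsilon> / cnm_sigma n T)) x 0 x (\<lambda>_. 0)"
    using assms by (simp add: steps_invariant_def)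
qed (use assms in auto)

end

section \<open>Counting trials\<close>

text \<open>After s successful and h halted trials. A halted trial doubles the trial value
  \<open>2 ^ ell * tau\<close>, a successful one at most halves it.\<close>

definition run_invariant ::
  "nat \<Rightarrow> (fseq \<Rightarrow> real) \<Rightarrow> (fseq \<Rightarrow> ereal) \<Rightarrow> fseq \<Rightarrow> real \<Rightarrow> real \<Rightarrow> real \<Rightarrow> nat \<Rightarrow> nat \<Rightarrow> cnm_state \<Rightarrow> bool"
  where "run_invariant n f \<psi> x0 \<tau>0 Tmax K s h st \<longleftrightarrow>
    iterate st \<in> eff_dom n \<psi> \<and> 0 < tau st \<and>
    \<tau>0 * 2 ^ h \<le> 2 ^ ell st * tau st * 2 ^ s \<and> 2 ^ ell st * tau st \<le> Tmax \<and>
    calls st \<le> (s + h) * (3 * n) \<and>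
    real s * K \<le> objective f \<psi> x0 - objective f \<psi> (iterate st)"

context lipschitz_hessian
begin

text \<open>A trial that does not stop the run raises exactly one of \<open>s\<close> and
  \<open>h\<close>, so \<open>s + h\<close> counts trials; the stopping trial is the extra one in
  \<open>Suc (s + h)\<close>.\<close>

lemma run_invariant_step:
  assumes "proper_closed_convex n \<psi>" "1 \<le> n" "0 \<le> L" "0 < \<tau>0" "0 < \<epsilon>"
    and Tmax: "\<tau>0 \<le> Tmax" "2 * L \<le> Tmax"
    and K: "K = \<epsilon> powr (3/2) / (384 * cnm_sigma n Tmax powr (1/2)) * real n"
    and inv: "run_invariant n f \<psi> x0 \<tau>0 Tmax K s h st"
    and "cnm_step n f \<psi> \<tau>0 \<epsilon> n st st'"
  shows "(if stopped st' then eps_stationary n f \<psi> \<epsilon> (iterate st') \<and> calls st' \<le> Suc (s + h) * (3 * n)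
    else run_invariant n f \<psi> x0 \<tau>0 Tmax K (Suc s) h st' \<or> run_invariant n f \<psi> x0 \<tau>0 Tmax K s (Suc h) st')"
proof -
  define T where "T = 2 ^ ell st * tau st"
  define x where "x = iterate st"
  have x: "x \<in> eff_dom n \<psi>" and tau: "0 < tau st" and low: "\<tau>0 * 2 ^ h \<le> T * 2 ^ s"
    and high: "T \<le> Tmax" and calls: "calls st \<le> (s + h) * (3 * n)"
    and decr: "real s * K \<le> objective f \<psi> x0 - objective f \<psi> x"
    using inv by (simp_all add: run_invariant_def T_def x_def)
  have "0 < T"
    using tau by (simp add: T_def)
  \<comment> \<open>The call count n + 1 + c is at most 2 n + 1, hence at most 3 n because n \<ge>
    1.\<close>
  have progress: "y \<in> eff_dom n \<psi> \<and> calls st + (n + 1) + c \<le> Suc (s + h) * (3 * n) \<and>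
      (\<alpha> = Solution \<longrightarrow> eps_stationary n f \<psi> \<epsilon> y) \<and>
      (\<alpha> = Success \<longrightarrow> K \<le> objective f \<psi> x - objective f \<psi> y)"
    if "cubic_steps n f \<psi> x (cnm_B n n f \<epsilon> x T) (cnm_sigma n T) n \<epsilon> y \<alpha> c" for y \<alpha> c
  proof -
    have 1: "y \<in> eff_dom n \<psi> \<and> c \<le> n \<and> (\<alpha> = Solution \<longrightarrow> eps_stationary n f \<psi> \<epsilon> y) \<and>
        (\<alpha> = Success \<longrightarrow> \<epsilon> powr (3/2) / (384 * cnm_sigma n T powr (1/2)) * real n
          \<le> objective f \<psi> x - objective f \<psi> y)"
      using cubic_loop_progress[OF assms(1) x that[unfolded cubic_steps_def]] x by simp
    \<comment> \<open>The guaranteed decrease shrinks as \<sigma> grows, so its value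
      \<open>K\<close> at \<open>Tmax\<close> is valid for every trial.\<close>
    have "cnm_sigma n T \<le> cnm_sigma n Tmax"
      using high by (simp add: cnm_sigma_def mult_right_mono)
    then have "K \<le> \<epsilon> powr (3/2) / (384 * cnm_sigma n T powr (1/2)) * real n"
      unfolding K using cnm_sigma_bounds(1)[OF \<open>0 < T\<close> assms(2)]
      by (intro mult_right_mono divide_left_mono mult_left_mono powr_mono2) auto
    with 1 calls \<open>1 \<le> n\<close> show ?thesis
      by auto
  qed
  show ?thesis
    using assms(10)
  proof cases
    case (halt T' y c)
    have run: "cubic_steps n f \<psi> x (cnm_B n n f \<epsilon> x T) (cnm_sigma n T) n \<epsilon> y Halt c"
      using halt by (simp add: x_def T_def)
    then have "\<not> L \<le> T"
      using cubic_steps_no_halt[OF assms(1) x assms(2,3) _ \<open>0 < T\<close> assms(5)] by blast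
    \<comment> \<open>A halt happens only for T < L, so the doubled trial value stays below 2
      L.\<close>
    then have "2 * T \<le> Tmax"
      using Tmax by linarith
    then have "run_invariant n f \<psi> x0 \<tau>0 Tmax K s (Suc h) st'"
      using progress[OF run] x tau low decr
      by (simp add: halt(1) run_invariant_def T_def x_def mult_ac)
    then show ?thesis
      using halt by simp
  next
    case (success T' y c)
    have run: "cubic_steps n f \<psi> x (cnm_B n n f \<epsilon> x T) (cnm_sigma n T) n \<epsilon> y Success c"
      using success by (simp add: x_def T_def)
    have st': "st' = \<lparr>iterate = y, tau = max \<tau>0 (T / 2), ell = 0,
        calls = calls st + (n + 1) + c, stopped = False\<rparr>"
      using success(1) by (simp add: T_def)
    \<comment> \<open>As \<open>ell\<close> is reset to 0, the next trial value is the new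
      \<open>tau\<close>, at least T / 2; one success thus costs a single factor 2.\<close>
    have "T \<le> 2 * max \<tau>0 (T / 2)"
      by simp
    then have "T * 2 ^ s \<le> 2 * max \<tau>0 (T / 2) * 2 ^ s"
      by (rule mult_right_mono) simp
    from order_trans[OF low this] have "\<tau>0 * 2 ^ h \<le> max \<tau>0 (T / 2) * 2 ^ Suc s"
      by (simp add: mult_ac)
    moreover have "max \<tau>0 (T / 2) \<le> Tmax" "0 < max \<tau>0 (T / 2)"
      using Tmax high \<open>0 < T\<close> \<open>0 < \<tau>0\<close> by auto
    moreover have "real (Suc s) * K \<le> objective f \<psi> x0 - objective f \<psi> y"
      using progress[OF run] decr by (simp add: distrib_right)
    ultimately have "run_invariant n f \<psi> x0 \<tau>0 Tmax K (Suc s) h st'"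
      using progress[OF run] by (simp add: st' run_invariant_def)
    then show ?thesis
      by (simp add: st')
  next
    case (solution T' y c)
    have run: "cubic_steps n f \<psi> x (cnm_B n n f \<epsilon> x T) (cnm_sigma n T) n \<epsilon> y Solution c"
      using solution by (simp add: x_def T_def)
    then show ?thesis
      using progress[OF run] by (simp add: solution(1))
  qed
qed

lemma run_invariant_iterate:
  assumes "proper_closed_convex n \<psi>" "1 \<le> n" "0 \<le> L" "0 < \<tau>0" "0 < \<epsilon>"
    and "\<tau>0 \<le> Tmax" "2 * L \<le> Tmax"
    and K: "K = \<epsilon> powr (3/2) / (384 * cnm_sigma n Tmax powr (1/2)) * real n"
    and "x0 \<in> eff_dom n \<psi>" and run: "cnm_run n f \<psi> x0 \<tau>0 \<epsilon> n S" and "\<And>j. j \<le> i \<Longrightarrow> \<not> stopped (S j)"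
  shows "\<exists>s h. s + h = i \<and> run_invariant n f \<psi> x0 \<tau>0 Tmax K s h (S i)"
  using assms(11)
proof (induction i)
  case 0
  have "S 0 = cnm_init x0 \<tau>0"
    using run by (simp add: cnm_run_def)
  then show ?case
    using assms by (simp add: run_invariant_def cnm_init_def)
next
  case (Suc i)
  then obtain s h where sh: "s + h = i" "run_invariant n f \<psi> x0 \<tau>0 Tmax K s h (S i)"
    by auto
  have "cnm_step n f \<psi> \<tau>0 \<epsilon> n (S i) (S (Suc i))"
    using run Suc.prems[of i] by (auto simp: cnm_run_def)
  from run_invariant_step[OF assms(1-8) sh(2) this] Suc.prems[of "Suc i"] sh(1)
  show ?case
    by (metis add_Suc add_Suc_right order_refl)
qed

end

section \<open>From trials to oracle calls\<close>

lemma opt_value_finite: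
  assumes "proper_closed_convex n \<psi>" "opt_value n f \<psi> > -\<infinity>" "x0 \<in> eff_dom n \<psi>"
  obtains F where "opt_value n f \<psi> = ereal F" "\<And>x. x \<in> eff_dom n \<psi> \<Longrightarrow> F \<le> objective f \<psi> x"
proof -
  have le: "opt_value n f \<psi> \<le> ereal (objective f \<psi> x)" if "x \<in> eff_dom n \<psi>" for x
    unfolding opt_value_def composite_eq[OF assms(1) that, symmetric] by (rule INF_lower[OF that])
  then obtain F where "opt_value n f \<psi> = ereal F"
    using le[OF assms(3)] assms(2) by (cases "opt_value n f \<psi>") auto
  with le that show thesis by auto
qed

text \<open>The total decrease bounds \<open>s\<close>. Taking logarithms of the balance between
  doublings and halvings bounds \<open>h\<close> by \<open>s\<close> plus a constant, hence the
  factor 2.\<close>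

lemma run_invariant_trials_le:
  assumes "run_invariant n f \<psi> x0 \<tau>0 Tmax K s h st" "0 < \<tau>0" "0 < K"
    and "\<And>x. x \<in> eff_dom n \<psi> \<Longrightarrow> F \<le> objective f \<psi> x"
  shows "real (s + h) \<le> 2 * ((objective f \<psi> x0 - F) / K) + log 2 (Tmax / \<tau>0)"
proof -
  have "real s * K \<le> objective f \<psi> x0 - F"
    using assms(1) assms(4)[of "iterate st"] by (simp add: run_invariant_def)
  then have s: "real s \<le> (objective f \<psi> x0 - F) / K"
    using \<open>0 < K\<close> by (simp add: pos_le_divide_eq)
  have "\<tau>0 * 2 ^ h \<le> 2 ^ ell st * tau st * 2 ^ s" "2 ^ ell st * tau st \<le> Tmax"
    using assms(1) by (simp_all add: run_invariant_def)
  then have "\<tau>0 * 2 ^ h \<le> Tmax * 2 ^ s"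
    by (meson mult_right_mono order_trans zero_le_numeral zero_le_power)
  then have "2 ^ h \<le> Tmax / \<tau>0 * 2 ^ s"
    using \<open>0 < \<tau>0\<close> by (simp add: field_simps)
  then have "log 2 (2 ^ h) \<le> log 2 (Tmax / \<tau>0 * 2 ^ s)"
    by (intro log_mono) auto
  moreover have "0 < \<tau>0 * 2 ^ h"
    using \<open>0 < \<tau>0\<close> by simp
  then have "0 < Tmax * 2 ^ s"
    using \<open>\<tau>0 * 2 ^ h \<le> Tmax * 2 ^ s\<close> by linarith
  then have "0 < Tmax / \<tau>0"
    using \<open>0 < \<tau>0\<close> by (simp add: zero_less_mult_iff)
  then have "log 2 (Tmax / \<tau>0 * 2 ^ s) = log 2 (Tmax / \<tau>0) + real s"
    by (auto simp add: log_mult simp del: times_divide_eq_left)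
  ultimately have "real h \<le> log 2 (Tmax / \<tau>0) + real s"
    by simp
  with s show ?thesis
    unfolding of_nat_add by linarith
qed

text \<open>\<open>K\<close> is proportional to n \<epsilon>^(3/2) / sqrt \<sigma>, and sqrt
  \<sigma> is at most 4 sqrt (n Tmax); the constant is 9216 = 384 * 6 * 4.\<close>

lemma calls_bound_le:
  assumes "0 < \<tau>0" "0 < \<epsilon>" "1 \<le> n" "\<tau>0 \<le> Tmax" "0 \<le> \<Delta>"
    and K: "K = \<epsilon> powr (3/2) / (384 * cnm_sigma n Tmax powr (1/2)) * real n"
  shows "(2 * (\<Delta> / K) + log 2 (Tmax / \<tau>0) + 1) * (3 * real n)
    \<le> (9216 * sqrt Tmax * \<Delta> + 3 * (log 2 (Tmax / \<tau>0) + 1)) *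
      (real n powr (1/2) * \<epsilon> powr (-3/2) + real n)"
proof -
  define a where "a = 9216 * sqrt Tmax * \<Delta>"
  define b where "b = 3 * (log 2 (Tmax / \<tau>0) + 1)"
  define u where "u = real n powr (1/2) * \<epsilon> powr (-3/2)"
  have nonneg: "0 \<le> a" "0 \<le> b" "0 \<le> u"
    using assms by (auto simp: a_def b_def u_def)
  define \<sigma> where "\<sigma> = cnm_sigma n Tmax"
  have \<sigma>: "0 < \<sigma>" "\<sigma> \<le> 16 * real n * Tmax"
    using cnm_sigma_bounds[of Tmax n] assms by (auto simp: \<sigma>_def)
  then have "sqrt \<sigma> \<le> sqrt (16 * real n * Tmax)"
    by simp
  also have "\<dots> = 4 * sqrt (real n) * sqrt Tmax"
    by (simp add: real_sqrt_mult)
  finally have sqrt_\<sigma>: "sqrt \<sigma> \<le> 4 * sqrt (real n) * sqrt Tmax" .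
  have "\<Delta> / K * (6 * real n) = 2304 * \<Delta> * \<epsilon> powr (-3/2) * sqrt \<sigma>"
    using assms \<sigma> unfolding K \<sigma>_def[symmetric]
    by (simp add: powr_minus powr_half_sqrt field_simps)
  also have "\<dots> \<le> 2304 * \<Delta> * \<epsilon> powr (-3/2) * (4 * sqrt (real n) * sqrt Tmax)"
    using sqrt_\<sigma> assms by (intro mult_left_mono) auto
  also have "\<dots> = a * u"
    by (simp add: a_def u_def powr_half_sqrt)
  finally have "(2 * (\<Delta> / K) + log 2 (Tmax / \<tau>0) + 1) * (3 * real n) \<le> a * u + b * real n"
    by (simp add: b_def algebra_simps)
  also have "\<dots> \<le> (a + b) * (u + real n)"
    using nonneg by (simp add: distrib_left distrib_right)
  finally show ?thesis
    unfolding a_def b_def u_def .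
qed

theorem corollary4p6:
  shows "\<exists>C :: real \<Rightarrow> real \<Rightarrow> real \<Rightarrow> real.
    \<forall>(n :: nat) (f :: fseq \<Rightarrow> real) (\<psi> :: fseq \<Rightarrow> ereal) (L :: real) (x0 :: fseq)
      (\<tau>0 :: real) (\<epsilon> :: real) (S :: nat \<Rightarrow> cnm_state).
      n \<ge> 1 \<longrightarrow> C2 n f \<longrightarrow> proper_closed_convex n \<psi> \<longrightarrow> opt_value n f \<psi> > -\<infinity> \<longrightarrow>
      L \<ge> 0 \<longrightarrow> hessian_lipschitz n f L \<longrightarrow>
      x0 \<in> eff_dom n \<psi> \<longrightarrow> \<tau>0 > 0 \<longrightarrow> \<epsilon> > 0 \<longrightarrow>
      cnm_run n f \<psi> x0 \<tau>0 \<epsilon> n S \<longrightarrow>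
      (\<exists>N. stopped (S N) \<and> eps_stationary n f \<psi> \<epsilon> (iterate (S N)) \<and>
        real (calls (S N)) \<le>
          C \<tau>0 L (real_of_ereal (composite f \<psi> x0 - opt_value n f \<psi>))
            * (real n powr (1/2) * \<epsilon> powr (-3/2) + real n))"
\<comment> \<open>The constant of \<open>calls_bound_le\<close>, with Tmax = max \<tau>0 (2
  L).\<close>
proof (rule exI[of _ "\<lambda>\<tau>0 L \<Delta>. 9216 * sqrt (max \<tau>0 (2 * L)) * \<Delta>
      + 3 * (log 2 (max \<tau>0 (2 * L) / \<tau>0) + 1)"], intro allI impI)
  fix n f \<psi> L x0 \<tau>0 \<epsilon> S
  assume n: "n \<ge> 1" and "C2 n f" and \<psi>: "proper_closed_convex n \<psi>"
    and opt: "opt_value n f \<psi> > -\<infinity>" and L: "L \<ge> (0::real)" and "hessian_lipschitz n f L"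
    and x0: "x0 \<in> eff_dom n \<psi>" and \<tau>0: "\<tau>0 > (0::real)" and \<epsilon>: "\<epsilon> > 0"
    and run: "cnm_run n f \<psi> x0 \<tau>0 \<epsilon> n S"
  interpret lipschitz_hessian n f L
    by standard fact+
  obtain F where F: "opt_value n f \<psi> = ereal F" "\<And>x. x \<in> eff_dom n \<psi> \<Longrightarrow> F \<le> objective f \<psi> x"
    using opt_value_finite[OF \<psi> opt x0] by blast
  define Tmax where "Tmax = max \<tau>0 (2 * L)"
  define K where "K = \<epsilon> powr (3/2) / (384 * cnm_sigma n Tmax powr (1/2)) * real n"
  define \<Delta> where "\<Delta> = objective f \<psi> x0 - F"
  define M where "M = 2 * (\<Delta> / K) + log 2 (Tmax / \<tau>0)"
  have Tmax: "\<tau>0 \<le> Tmax" "2 * L \<le> Tmax" "0 < Tmax"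
    using \<tau>0 by (auto simp: Tmax_def)
  have "0 < K"
    using cnm_sigma_bounds(1)[OF Tmax(3) n] \<epsilon> n by (simp add: K_def)
  have "0 \<le> \<Delta>"
    using F(2)[OF x0] by (simp add: \<Delta>_def)
  note iterate = run_invariant_iterate[OF \<psi> n L \<tau>0 \<epsilon> Tmax(1,2) K_def x0 run]
  have trials: "real i \<le> M" if "\<And>j. j \<le> i \<Longrightarrow> \<not> stopped (S j)" for i
    using iterate[OF that] run_invariant_trials_le[OF _ \<tau>0 \<open>0 < K\<close> F(2)]
    unfolding M_def \<Delta>_def by blast
  \<comment> \<open>A run unstopped up to this index would contain more trials than allowed.\<close>
  obtain i where "M < real i"
    using reals_Archimedean2 by blast
  then have ex: "\<exists>N. stopped (S N)"
    using trials[of i] by force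
  \<comment> \<open>The first stopped index: the invariant covers all earlier states, and one last
    step leads to \<open>N\<close>.\<close>
  define N where "N = (LEAST N. stopped (S N))"
  have before: "\<not> stopped (S j)" if "j < N" for j
    using not_less_Least that by (auto simp: N_def)
  have stopped: "stopped (S N)"
    using LeastI_ex[OF ex] by (simp add: N_def)
  have "\<not> stopped (S 0)"
    using run by (simp add: cnm_run_def cnm_init_def)
  then obtain i where i: "N = Suc i"
    using stopped by (cases N) auto
  have unstopped: "\<not> stopped (S j)" if "j \<le> i" for j
    using before i that by simp
  obtain s h where sh: "s + h = i" and inv: "run_invariant n f \<psi> x0 \<tau>0 Tmax K s h (S i)"
    using iterate[OF unstopped] by blast
  have "cnm_step n f \<psi> \<tau>0 \<epsilon> n (S i) (S N)"
    using run unstopped[of i] by (auto simp: cnm_run_def i)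
  from run_invariant_step[OF \<psi> n L \<tau>0 \<epsilon> Tmax(1,2) K_def inv this] stopped
  have final: "eps_stationary n f \<psi> \<epsilon> (iterate (S N))" and calls: "calls (S N) \<le> Suc i * (3 * n)"
    by (auto simp: sh)
  have "real (calls (S N)) \<le> real (Suc i * (3 * n))"
    using calls by (simp only: of_nat_le_iff)
  also have "\<dots> = (real i + 1) * (3 * real n)"
    by (simp add: algebra_simps)
  \<comment> \<open>The 1 accounts for the trial that stops the run.\<close>
  also have "\<dots> \<le> (M + 1) * (3 * real n)"
    using trials[OF unstopped] by (intro mult_right_mono) auto
  also have "\<dots> \<le> (9216 * sqrt Tmax * \<Delta> + 3 * (log 2 (Tmax / \<tau>0) + 1)) *
      (real n powr (1/2) * \<epsilon> powr (-3/2) + real n)"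
    unfolding M_def by (rule calls_bound_le[OF \<tau>0 \<epsilon> n Tmax(1) \<open>0 \<le> \<Delta>\<close> K_def])
  moreover have "real_of_ereal (composite f \<psi> x0 - opt_value n f \<psi>) = \<Delta>"
    by (simp add: composite_eq[OF \<psi> x0] F(1) \<Delta>_def)
  ultimately show "\<exists>N. stopped (S N) \<and> eps_stationary n f \<psi> \<epsilon> (iterate (S N)) \<and>
      real (calls (S N)) \<le> (9216 * sqrt (max \<tau>0 (2 * L)) * real_of_ereal (composite f \<psi> x0 - opt_value n f \<psi>)
        + 3 * (log 2 (max \<tau>0 (2 * L) / \<tau>0) + 1)) * (real n powr (1/2) * \<epsilon> powr (-3/2) + real n)"
    using stopped final unfolding Tmax_def by (intro exI[of _ N]) simp
qed

end
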